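(* If $L\in\mathrm{SH}$ and $L\leq^p_{m,\ell i}L$, then $L\in\mathrm{P\text{-}Sel}$.
   Context: Sets are languages over $\Sigma=\{0,1\}$; FP is the class of polynomial-time computable functions. For a positive integer $k$, $\mathrm{S}(k)$ is the class of sets $L$ for which there is an FP function $f$ such that for every $n\geq 1$ and all distinct strings $y_1,\dots,y_n$ (given as a tuple in lexicographic order): $f(y_1,\dots,y_n)\subseteq\{y_1,\dots,y_n\}$, and if $\|L\cap\{y_1,\dots,y_n\}\|\geq k$ then $f(y_1,\dots,y_n)\subseteq L$ and $\|f(y_1,\dots,y_n)\|\geq 1$; $\mathrm{SH}=\bigcup_{k\geq1}\mathrm{S}(k)$. A set $L$ is P-selective ($L\in\mathrm{P\text{-}Sel}$) if there is an FP function $f$ such that for all $x,y$, $f(x,y)\in\{x,y\}$ and if $x\in L$ or $y\in L$ then $f(x,y)\in L$. For sets $A,B$, $A\leq^p_{m,\ell i}B$ means there is an FP function $f$ such that for all $x$: $x\in A\iff f(x)\in B$, and $x<_{\mathrm{lex}}f(x)$ (lexicographic order). *)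

theory Defs
  imports Main "HOL-Computational_Algebra.Polynomial"
begin

section \<open>Words over the binary alphabet\<close>

type_synonym word = "bool list"
type_synonym lang = "word set"

text \<open>The usual order of complexity theory on binary words: shorter words come first, words of
  equal length are compared by dictionary order (\<open>False\<close> is the letter 0, \<open>True\<close> the letter 1).\<close>

definition lex_less :: "word \<Rightarrow> word \<Rightarrow> bool"  (infix "<\<^sub>l\<^sub>e\<^sub>x" 50) where
  "x <\<^sub>l\<^sub>e\<^sub>x y \<longleftrightarrow> (x, y) \<in> lenlex {(False, True)}"


section \<open>Deterministic multi-tape Turing machines\<close>

datatype move = Left | Stay | Right

text \<open>States and tape symbols are drawn from finite sets of natural numbers. The symbols 0, 1, 2
  are the blank and the letters 0 and 1. A transition maps the state and the scanned symbols (one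
  per tape) to the next state and, for each tape, the symbol written and the head movement.\<close>

record tm =
  tapes :: nat
  states :: "nat set"
  alphabet :: "nat set"
  start :: nat
  halt :: nat
  trans :: "nat \<Rightarrow> nat list \<Rightarrow> nat \<times> (nat \<times> move) list"

abbreviation blank :: nat where "blank \<equiv> 0"

definition letter :: "bool \<Rightarrow> nat" where
  "letter b = (if b then 2 else 1)"

definition wf_tm :: "tm \<Rightarrow> bool" where
  "wf_tm M \<longleftrightarrow>
     tapes M \<ge> 1 \<and> finite (states M) \<and> finite (alphabet M) \<and>
     start M \<in> states M \<and> halt M \<in> states M \<and>
     {blank, letter False, letter True} \<subseteq> alphabet M \<and>
     (\<forall>q \<in> states M. \<forall>s. length s = tapes M \<and> set s \<subseteq> alphabet M \<longrightarrow>
        fst (trans M q s) \<in> states M \<and>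
        length (snd (trans M q s)) = tapes M \<and>
        fst ` set (snd (trans M q s)) \<subseteq> alphabet M)"

text \<open>A tape is infinite in both directions: the head position and the content of every cell.\<close>

type_synonym tape = "int \<times> (int \<Rightarrow> nat)"
type_synonym config = "nat \<times> tape list"

fun scanned :: "tape \<Rightarrow> nat" where
  "scanned (p, c) = c p"

fun shift :: "move \<Rightarrow> int" where
  "shift Left = - 1"
| "shift Stay = 0"
| "shift Right = 1"

fun act :: "nat \<times> move \<Rightarrow> tape \<Rightarrow> tape" where
  "act (a, m) (p, c) = (p + shift m, c(p := a))"

fun step :: "tm \<Rightarrow> config \<Rightarrow> config" where
  "step M (q, ts) =
     (if q = halt M then (q, ts)
      else let (q', as) = trans M q (map scanned ts) in (q', map2 act as ts))"

definition blank_tape :: tape where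
  "blank_tape = (0, \<lambda>_. blank)"

definition input_tape :: "word \<Rightarrow> tape" where
  "input_tape x =
     (0, \<lambda>i. if 0 \<le> i \<and> i < int (length x) then letter (x ! nat i) else blank)"

definition initial :: "tm \<Rightarrow> word \<Rightarrow> config" where
  "initial M x = (start M, input_tape x # replicate (tapes M - 1) blank_tape)"

text \<open>The word that starts at the head position and extends to the next blank.\<close>

fun tape_word :: "tape \<Rightarrow> word \<Rightarrow> bool" where
  "tape_word (p, c) w \<longleftrightarrow>
     (\<forall>i < length w. c (p + int i) = letter (w ! i)) \<and> c (p + int (length w)) = blank"

text \<open>Input is on the first tape, output on the last one. Halting configurations are fixed
  points of \<open>step\<close>, so this says that \<open>M\<close> halts after at most \<open>t\<close> steps.\<close>

definition outputs_within :: "tm \<Rightarrow> word \<Rightarrow> word \<Rightarrow> nat \<Rightarrow> bool" where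
  "outputs_within M x w t \<longleftrightarrow>
     (\<exists>ts. (step M ^^ t) (initial M x) = (halt M, ts) \<and> tape_word (last ts) w)"

definition FP :: "(word \<Rightarrow> word) set" where
  "FP = {f. \<exists>M (p :: nat poly). wf_tm M \<and>
              (\<forall>x. outputs_within M x (f x) (poly p (length x)))}"


section \<open>Tuples and finite sets of words as words\<close>

text \<open>Each letter \<open>b\<close> of a component is written as \<open>1b\<close>, and each component is terminated by 0.\<close>

definition enc_word :: "word \<Rightarrow> word" where
  "enc_word x = concat (map (\<lambda>b. [True, b]) x) @ [False]"

definition enc_tuple :: "word list \<Rightarrow> word" where
  "enc_tuple xs = concat (map enc_word xs)"

lemma enc_word_append_inject:
  "enc_word x @ u = enc_word y @ v \<longleftrightarrow> x = y \<and> u = v"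
proof (induction x arbitrary: y)
  case Nil
  then show ?case by (cases y) (auto simp: enc_word_def)
next
  case (Cons a x)
  then show ?case by (cases y) (auto simp: enc_word_def)
qed

lemma inj_enc_tuple: "inj enc_tuple"
proof (rule injI)
  fix xs ys :: "word list"
  assume "enc_tuple xs = enc_tuple ys"
  then show "xs = ys"
  proof (induction xs arbitrary: ys)
    case Nil
    then show ?case by (cases ys) (auto simp: enc_tuple_def enc_word_def)
  next
    case (Cons x xs)
    then show ?case
      by (cases ys) (auto simp: enc_tuple_def enc_word_append_inject, simp add: enc_word_def)
  qed
qed

text \<open>Polynomial-time computability of a set-valued function on nonempty tuples of distinct words
  listed in lexicographic order; the finite set that is the value is output as the
  lexicographically ordered tuple of its elements.\<close>

definition FP_tuple_set :: "(word list \<Rightarrow> word set) \<Rightarrow> bool" where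
  "FP_tuple_set f \<longleftrightarrow>
     (\<exists>F \<in> FP. \<forall>ys. ys \<noteq> [] \<and> sorted_wrt (<\<^sub>l\<^sub>e\<^sub>x) ys \<longrightarrow>
        (\<exists>zs. sorted_wrt (<\<^sub>l\<^sub>e\<^sub>x) zs \<and> set zs = f ys \<and> F (enc_tuple ys) = enc_tuple zs))"

definition FP_pair :: "(word \<Rightarrow> word \<Rightarrow> word) \<Rightarrow> bool" where
  "FP_pair f \<longleftrightarrow> (\<exists>F \<in> FP. \<forall>x y. F (enc_tuple [x, y]) = f x y)"


section \<open>The classes and the reducibility\<close>

definition S :: "nat \<Rightarrow> lang set" where
  "S k = {L. \<exists>f. FP_tuple_set f \<and>
     (\<forall>ys. ys \<noteq> [] \<and> sorted_wrt (<\<^sub>l\<^sub>e\<^sub>x) ys \<longrightarrow>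
        f ys \<subseteq> set ys \<and>
        (card (L \<inter> set ys) \<ge> k \<longrightarrow> f ys \<subseteq> L \<and> card (f ys) \<ge> 1))}"

definition SH :: "lang set" where
  "SH = (\<Union>k \<in> {1..}. S k)"

definition P_Sel :: "lang set" where
  "P_Sel = {L. \<exists>f. FP_pair f \<and>
     (\<forall>x y. f x y \<in> {x, y} \<and> (x \<in> L \<or> y \<in> L \<longrightarrow> f x y \<in> L))}"

definition m_li_reducible :: "lang \<Rightarrow> lang \<Rightarrow> bool"  (infix "\<le>\<^sub>m\<^sub>l\<^sub>i" 50) where
  "A \<le>\<^sub>m\<^sub>l\<^sub>i B \<longleftrightarrow> (\<exists>f \<in> FP. \<forall>x. (x \<in> A \<longleftrightarrow> f x \<in> B) \<and> x <\<^sub>l\<^sub>e\<^sub>x f x)"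

end

theory Submission imports Defs begin

text \<open>
  Let \<open>s\<close> witness \<open>L \<in> S k\<close> and let \<open>g\<close> be the lexicographically increasing self-reduction. The chain
  \<open>x, g x, \<dots>, g\<^sup>k\<^sup>-\<^sup>1 x\<close> consists of \<open>k\<close> distinct words that all have the same membership status as \<open>x\<close>.
  If \<open>x\<close> or \<open>y\<close> is in \<open>L\<close>, the union of the two chains has at least \<open>k\<close> members in \<open>L\<close>, so
  every word selected from it by \<open>s\<close> is in \<open>L\<close>, and \<open>x\<close> or \<open>y\<close> is chosen according to the
  chain in which the first selected word lies.

  Since \<open>k\<close> is fixed, sorting the chains and testing membership in them are finite case distinctions
  on comparisons. Hence it suffices that \<open>FP\<close> is closed under composition and under postprocessing the
  values of two \<open>FP\<close> functions by a finite-state transducer that reads both of them in one pass: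
  pairing, branching on a decoded pair, and comparison are of this form.
\<close>

section \<open>Runs, sequential composition and embedding of machines\<close>

text \<open>The starting tapes are arbitrary because a component of a composite machine starts on
  the tapes left by its predecessors. An upper bound on the time, instead of the exact time, lets
  estimates be rounded up.\<close>

definition reaches :: "tm \<Rightarrow> tape list \<Rightarrow> nat \<Rightarrow> tape list \<Rightarrow> bool" where
  "reaches M ts n ts' \<longleftrightarrow> (\<exists>t\<le>n. (step M ^^ t) (start M, ts) = (halt M, ts'))"

definition tapes_over :: "nat set \<Rightarrow> tape list \<Rightarrow> bool" where
  "tapes_over A ts \<longleftrightarrow> (\<forall>t\<in>set ts. range (snd t) \<subseteq> A)"

text \<open>The invariant of runs under which the closure condition of \<open>wf_tm\<close> applies
  to every transition.\<close>

definition valid_config :: "tm \<Rightarrow> config \<Rightarrow> bool" where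
  "valid_config M c \<longleftrightarrow> fst c \<in> states M \<and> length (snd c) = tapes M \<and> tapes_over (alphabet M) (snd c)"

declare step.simps [simp del]

lemma step_halt [simp]: "step M (halt M, ts) = (halt M, ts)"
  by (simp add: step.simps)

lemma funpow_step_halt [simp]: "(step M ^^ t) (halt M, ts) = (halt M, ts)"
  by (induction t) simp_all

lemma reachesI: "(step M ^^ n) (start M, ts) = (halt M, ts') \<Longrightarrow> reaches M ts n ts'"
  by (auto simp: reaches_def)

lemma reaches_mono: "reaches M ts n ts' \<Longrightarrow> n \<le> m \<Longrightarrow> reaches M ts m ts'"
  unfolding reaches_def by (meson le_trans)

lemma reaches_exact:
  assumes "reaches M ts n ts'"
  shows "(step M ^^ n) (start M, ts) = (halt M, ts')"
proof -
  obtain t where t: "t \<le> n" "(step M ^^ t) (start M, ts) = (halt M, ts')"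
    using assms by (auto simp: reaches_def)
  have "(step M ^^ n) (start M, ts) = (step M ^^ (n - t)) ((step M ^^ t) (start M, ts))"
    using t(1) by (simp flip: funpow_add[THEN fun_cong, unfolded o_apply])
  also have "\<dots> = (halt M, ts')" by (simp only: t(2) funpow_step_halt)
  finally show ?thesis .
qed

lemma scanned_snd: "scanned t = snd t (fst t)"
  by (cases t) simp

lemma act_noop [simp]: "act (scanned t, Stay) t = t"
  by (cases t) simp

lemma range_act: "range (snd t) \<subseteq> A \<Longrightarrow> fst a \<in> A \<Longrightarrow> range (snd (act a t)) \<subseteq> A"
  by (cases t; cases a) auto

lemma tapes_over_scanned: "tapes_over A ts \<Longrightarrow> set (map scanned ts) \<subseteq> A"
  by (auto simp: tapes_over_def scanned_snd)

lemma valid_config_step: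
  assumes "wf_tm M" "valid_config M c"
  shows "valid_config M (step M c)"
proof -
  obtain q ts where c: "c = (q, ts)" by fastforce
  obtain q' as where tr: "trans M q (map scanned ts) = (q', as)" by fastforce
  have *: "q \<in> states M" "length ts = tapes M" "tapes_over (alphabet M) ts"
    using assms by (auto simp: valid_config_def c)
  then have "length (map scanned ts) = tapes M \<and> set (map scanned ts) \<subseteq> alphabet M"
    using tapes_over_scanned by simp
  then have **: "q' \<in> states M" "length as = tapes M" "fst ` set as \<subseteq> alphabet M"
    using assms(1) *(1) tr unfolding wf_tm_def by (metis fst_conv snd_conv)+
  have "tapes_over (alphabet M) (map2 act as ts)"
    unfolding tapes_over_def
  proof
    fix t assume "t \<in> set (map2 act as ts)"
    then obtain i where i: "i < length as" "i < length ts" "t = act (as ! i) (ts ! i)"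
      by (auto simp: in_set_conv_nth)
    then have "range (snd (ts ! i)) \<subseteq> alphabet M" "fst (as ! i) \<in> alphabet M"
      using *(3) **(3) nth_mem unfolding tapes_over_def by blast+
    then show "range (snd t) \<subseteq> alphabet M"
      unfolding i(3) by (rule range_act)
  qed
  then show ?thesis using * ** tr by (auto simp: c valid_config_def step.simps)
qed

lemma valid_config_funpow:
  "wf_tm M \<Longrightarrow> valid_config M c \<Longrightarrow> valid_config M ((step M ^^ t) c)"
  by (induction t) (simp_all add: valid_config_step)

lemma valid_config_start:
  "wf_tm M \<Longrightarrow> length ts = tapes M \<Longrightarrow> tapes_over (alphabet M) ts \<Longrightarrow> valid_config M (start M, ts)"
  by (simp add: valid_config_def wf_tm_def)

lemma reaches_valid:
  assumes "wf_tm M" "length ts = tapes M" "tapes_over (alphabet M) ts" "reaches M ts n ts'"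
  shows "length ts' = tapes M \<and> tapes_over (alphabet M) ts'"
  using valid_config_funpow[OF assms(1) valid_config_start[OF assms(1-3)]] reaches_exact[OF assms(4)]
  by (metis snd_conv valid_config_def)

section \<open>Sequential composition of two machines\<close>

text \<open>The parity of a state tells which machine is running. Leaving the halt state of
  \<open>M\<close> costs one step that changes only the state; this is the \<open>+ 1\<close> in the
  composed running time.\<close>

definition seq_tm :: "tm \<Rightarrow> tm \<Rightarrow> tm" where
  "seq_tm M N = \<lparr> tapes = tapes M,
     states = (\<lambda>q. 2 * q) ` states M \<union> (\<lambda>q. 2 * q + 1) ` states N,
     alphabet = alphabet M, start = 2 * start M, halt = 2 * halt N + 1,
     trans = (\<lambda>q s.
       if even q then
         if q div 2 = halt M then (2 * start N + 1, map (\<lambda>a. (a, Stay)) s)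
         else map_prod (\<lambda>q'. 2 * q') id (trans M (q div 2) s)
       else map_prod (\<lambda>q'. 2 * q' + 1) id (trans N (q div 2) s)) \<rparr>"

lemma seq_tm_simps [simp]:
  "tapes (seq_tm M N) = tapes M" "alphabet (seq_tm M N) = alphabet M"
  "start (seq_tm M N) = 2 * start M" "halt (seq_tm M N) = 2 * halt N + 1"
  by (simp_all add: seq_tm_def)

lemma wf_seq_tm:
  assumes "wf_tm M" "wf_tm N" "tapes M = tapes N" "alphabet M = alphabet N"
  shows "wf_tm (seq_tm M N)"
proof -
  have wfD: "fst (trans P q s) \<in> states P" "length (snd (trans P q s)) = tapes M"
      "fst ` set (snd (trans P q s)) \<subseteq> alphabet M"
    if "P = M \<or> P = N" "q \<in> states P" "length s = tapes M" "set s \<subseteq> alphabet M" for P q s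
    using assms that unfolding wf_tm_def by metis+
  have "fst (trans (seq_tm M N) q s) \<in> states (seq_tm M N) \<and>
        length (snd (trans (seq_tm M N) q s)) = tapes M \<and>
        fst ` set (snd (trans (seq_tm M N) q s)) \<subseteq> alphabet M"
    if q: "q \<in> states (seq_tm M N)" and s: "length s = tapes M" "set s \<subseteq> alphabet M" for q s
  proof (cases "even q")
    case True
    then have "q div 2 \<in> states M" using q by (auto simp: seq_tm_def)
    moreover have "start N \<in> states N" using assms(2) by (simp add: wf_tm_def)
    ultimately show ?thesis
      using True s wfD[of M "q div 2" s] by (simp add: seq_tm_def image_image)
  next
    case False
    then have "q div 2 \<in> states N" using q by (auto simp: seq_tm_def)
    then show ?thesis
      using False s wfD[of N "q div 2" s] by (simp add: seq_tm_def)
  qed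
  moreover have "finite (states (seq_tm M N))" "start (seq_tm M N) \<in> states (seq_tm M N)"
    "halt (seq_tm M N) \<in> states (seq_tm M N)"
    using assms(1,2) by (auto simp: wf_tm_def seq_tm_def)
  ultimately show ?thesis
    using assms(1) by (simp add: wf_tm_def)
qed

lemma map2_noop: "map2 act (map (\<lambda>a. (a, Stay)) (map scanned ts)) ts = ts"
  by (rule nth_equalityI) simp_all

text \<open>Only some \<open>t' \<le> t\<close> can be promised: \<open>M\<close> may halt early and
  then idles, whereas the composite machine goes on from \<open>2 * halt M\<close> to
  \<open>N\<close>.\<close>

lemma seq_tm_first:
  "(step M ^^ t) (q, ts) = (halt M, ts') \<Longrightarrow>
   \<exists>t'\<le>t. (step (seq_tm M N) ^^ t') (2 * q, ts) = (2 * halt M, ts')"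
proof (induction t arbitrary: q ts)
  case 0
  then show ?case by simp
next
  case (Suc t)
  show ?case
  proof (cases "q = halt M")
    case True
    then have "ts = ts'" using Suc.prems by (simp del: funpow.simps(2))
    then show ?thesis using True by (intro exI[of _ 0]) simp
  next
    case False
    obtain q1 ts1 where c1: "step M (q, ts) = (q1, ts1)" by fastforce
    then have "(step M ^^ t) (q1, ts1) = (halt M, ts')"
      using Suc.prems by (simp only: funpow_Suc_right o_apply)
    then obtain t' where t': "t' \<le> t" "(step (seq_tm M N) ^^ t') (2 * q1, ts1) = (2 * halt M, ts')"
      using Suc.IH by blast
    have "step (seq_tm M N) (2 * q, ts) = (2 * q1, ts1)"
      using c1 False by (auto simp: seq_tm_def Let_def step.simps split: prod.splits) presburger+
    with t' show ?thesis
      by (intro exI[of _ "Suc t'"]) (simp only: funpow_Suc_right o_apply Suc_le_mono)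
  qed
qed

lemma seq_tm_glue: "step (seq_tm M N) (2 * halt M, ts) = (2 * start N + 1, ts)"
proof -
  have "2 * halt M \<noteq> 2 * halt N + 1" by presburger
  moreover have "trans (seq_tm M N) (2 * halt M) s = (2 * start N + 1, map (\<lambda>a. (a, Stay)) s)" for s
    by (simp add: seq_tm_def)
  ultimately show ?thesis
    by (simp only: step.simps seq_tm_simps if_False Let_def prod.case map2_noop)
qed

text \<open>In contrast to the first phase the simulation is exact, because the halt state of
  \<open>N\<close> corresponds to that of the composite machine.\<close>

lemma seq_tm_second:
  "(step (seq_tm M N) ^^ t) (2 * q + 1, ts) = map_prod (\<lambda>q. 2 * q + 1) id ((step N ^^ t) (q, ts))"
proof (induction t)
  case (Suc t)
  have "step (seq_tm M N) (map_prod (\<lambda>q. 2 * q + 1) id c) = map_prod (\<lambda>q. 2 * q + 1) id (step N c)" for c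
    by (cases c) (auto simp: seq_tm_def Let_def step.simps split: prod.splits)
  with Suc show ?case by (simp only: funpow.simps o_apply)
qed simp

lemma reaches_seq_tm:
  assumes "reaches M ts m ts1" "reaches N ts1 n ts2"
  shows "reaches (seq_tm M N) ts (m + n + 1) ts2"
proof -
  obtain t where t: "t \<le> m" "(step (seq_tm M N) ^^ t) (2 * start M, ts) = (2 * halt M, ts1)"
    using seq_tm_first[OF reaches_exact[OF assms(1)]] by blast
  have "(step (seq_tm M N) ^^ n) (2 * start N + 1, ts1) = (2 * halt N + 1, ts2)"
    using reaches_exact[OF assms(2)] by (simp only: seq_tm_second map_prod_simp id_apply)
  then have "(step (seq_tm M N) ^^ (n + Suc t)) (2 * start M, ts) = (2 * halt N + 1, ts2)"
    using t(2) by (simp only: funpow_add funpow.simps o_apply seq_tm_glue)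
  then show ?thesis
    using t(1) unfolding reaches_def by (intro exI[of _ "n + Suc t"]) simp
qed

section \<open>Running a machine on selected tapes of a larger one\<close>

text \<open>Serves both for tapes and for the actions performed on them, hence the polymorphic type.
  The function \<sigma> gives the values at the indices outside the list.\<close>

definition override :: "(nat \<Rightarrow> 'a) \<Rightarrow> nat list \<Rightarrow> 'a list \<Rightarrow> nat \<Rightarrow> 'a" where
  "override \<sigma> is as j = (case map_of (zip is as) j of None \<Rightarrow> \<sigma> j | Some a \<Rightarrow> a)"

lemma override_nth [simp]:
  "distinct is \<Longrightarrow> length is = length as \<Longrightarrow> i < length is \<Longrightarrow> override \<sigma> is as (is ! i) = as ! i"
  by (simp add: override_def map_of_zip_nth)

lemma override_other [simp]:
  "length is = length as \<Longrightarrow> j \<notin> set is \<Longrightarrow> override \<sigma> is as j = \<sigma> j"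
  by (auto simp: override_def split: option.splits dest!: map_of_SomeD set_zip_leftD)

lemma map_override [simp]:
  "distinct is \<Longrightarrow> length is = length as \<Longrightarrow> map (override \<sigma> is as) is = as"
  by (rule nth_equalityI) simp_all

lemma override_override [simp]:
  assumes "distinct is" "length is = length as" "length is = length bs"
  shows "override (override \<sigma> is as) is bs = override \<sigma> is bs"
proof
  fix j show "override (override \<sigma> is as) is bs j = override \<sigma> is bs j"
    using assms by (cases "j \<in> set is") (auto simp: in_set_conv_nth)
qed

lemma override_map_self [simp]: "distinct is \<Longrightarrow> override \<sigma> is (map \<sigma> is) = \<sigma>"
proof
  fix j assume "distinct is"
  then show "override \<sigma> is (map \<sigma> is) j = \<sigma> j"
    by (cases "j \<in> set is") (auto simp: in_set_conv_nth)
qed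

text \<open>The guard on the scanned symbols only serves to make the machine well formed over the larger
  alphabet; it never fails in a run on tapes over the alphabet of the embedded machine.\<close>

definition embed_tm :: "nat \<Rightarrow> nat set \<Rightarrow> nat list \<Rightarrow> tm \<Rightarrow> tm" where
  "embed_tm K A is M = \<lparr> tapes = K, states = states M, alphabet = A, start = start M, halt = halt M,
     trans = (\<lambda>q s.
       if set (map ((!) s) is) \<subseteq> alphabet M then
         map_prod id (\<lambda>as. map (override (\<lambda>j. (s ! j, Stay)) is as) [0..<K]) (trans M q (map ((!) s) is))
       else (halt M, map (\<lambda>j. (s ! j, Stay)) [0..<K])) \<rparr>"

lemma embed_tm_simps [simp]:
  "tapes (embed_tm K A is M) = K" "alphabet (embed_tm K A is M) = A"
  "start (embed_tm K A is M) = start M" "halt (embed_tm K A is M) = halt M"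
  by (simp_all add: embed_tm_def)

lemma wf_embed_tm:
  assumes "wf_tm M" "distinct is" "length is = tapes M" "set is \<subseteq> {..<K}"
    "alphabet M \<subseteq> A" "finite A"
  shows "wf_tm (embed_tm K A is M)"
proof -
  have K: "K \<ge> 1"
    using assms(1,3,4) by (cases "is") (auto simp: wf_tm_def)
  have "fst (trans (embed_tm K A is M) q s) \<in> states M \<and>
        length (snd (trans (embed_tm K A is M) q s)) = K \<and>
        fst ` set (snd (trans (embed_tm K A is M) q s)) \<subseteq> A"
    if q: "q \<in> states M" and s: "length s = K" "set s \<subseteq> A" for q s
  proof (cases "set (map ((!) s) is) \<subseteq> alphabet M")
    case False
    then show ?thesis
      using s assms(1) by (auto simp: embed_tm_def wf_tm_def)
  next
    case True
    obtain q' as where tr: "trans M q (map ((!) s) is) = (q', as)" by fastforce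
    have *: "q' \<in> states M" "length as = tapes M" "fst ` set as \<subseteq> alphabet M"
      using True assms(1,3) q tr unfolding wf_tm_def by (metis fst_conv snd_conv length_map)+
    have "fst (override (\<lambda>j. (s ! j, Stay)) is as j) \<in> A" if "j < K" for j
    proof (cases "j \<in> set is")
      case True
      then obtain i where i: "i < length is" "j = is ! i" by (auto simp: in_set_conv_nth)
      then have "override (\<lambda>j. (s ! j, Stay)) is as j \<in> set as"
        using assms(2,3) * by simp
      then show ?thesis using *(3) assms(5) by blast
    next
      case False
      then show ?thesis using assms(3) * s that by auto
    qed
    then show ?thesis
      using True tr * by (auto simp: embed_tm_def)
  qed
  then show ?thesis
    using K assms by (auto simp: wf_tm_def embed_tm_def)
qed

text \<open>On a selected tape the embedded machine performs the action of \<open>M\<close>; on any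
  other tape it rewrites the scanned symbol and stays, which is the identity by
  \<open>act_noop\<close>.\<close>

lemma step_embed_tm:
  assumes "wf_tm M" "distinct is" "length is = tapes M" "set is \<subseteq> {..<K}"
    and "valid_config M (q, map \<sigma> is)" "step M (q, map \<sigma> is) = (q', ts')"
  shows "step (embed_tm K A is M) (q, map \<sigma> [0..<K]) = (q', map (override \<sigma> is ts') [0..<K])"
proof (cases "q = halt M")
  case True
  then show ?thesis using assms by (auto simp: step.simps embed_tm_def)
next
  case False
  have nth: "map ((!) (map scanned (map \<sigma> [0..<K]))) is = map scanned (map \<sigma> is)"
    using assms(4) by auto
  \<comment> \<open>This is the guard in \<open>embed_tm\<close>, so the first branch of its
    transition function is taken.\<close>
  have over: "set (map scanned (map \<sigma> is)) \<subseteq> alphabet M"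
    using assms(5) tapes_over_scanned unfolding valid_config_def snd_conv by blast
  obtain as where tr: "trans M q (map scanned (map \<sigma> is)) = (q', as)"
    and ts': "ts' = map2 act as (map \<sigma> is)"
    using assms(6) False by (auto simp: step.simps split: prod.splits)
  have len: "length as = tapes M"
    using assms(1,3,5) over tr unfolding wf_tm_def valid_config_def
    by (metis fst_conv snd_conv length_map)
  have *: "act (override (\<lambda>j. (map scanned (map \<sigma> [0..<K]) ! j, Stay)) is as j) (\<sigma> j) = override \<sigma> is ts' j"
    if j: "j < K" for j
  proof (cases "j \<in> set is")
    case True
    then obtain i where i: "i < length is" "j = is ! i" by (auto simp: in_set_conv_nth)
    then show ?thesis using assms(2,3) len by (simp add: ts')
  next
    case False
    then show ?thesis using assms(3) len j by (simp add: ts')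
  qed
  let ?s = "map scanned (map \<sigma> [0..<K])"
  have "trans (embed_tm K A is M) q ?s = (q', map (override (\<lambda>j. (?s ! j, Stay)) is as) [0..<K])"
    unfolding embed_tm_def tm.simps nth tr using over by simp
  then have "step (embed_tm K A is M) (q, map \<sigma> [0..<K]) =
    (q', map2 act (map (override (\<lambda>j. (?s ! j, Stay)) is as) [0..<K]) (map \<sigma> [0..<K]))"
    using False unfolding step.simps embed_tm_simps by simp
  also have "\<dots> = (q', map (override \<sigma> is ts') [0..<K])"
    unfolding prod.inject using * by (intro conjI refl nth_equalityI) simp_all
  finally show ?thesis .
qed

lemma reaches_embed_tm:
  assumes wf: "wf_tm M" and idx: "distinct is" "length is = tapes M" "set is \<subseteq> {..<K}"
    and over: "tapes_over (alphabet M) (map \<sigma> is)" and run: "reaches M (map \<sigma> is) n ts'"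
  shows "reaches (embed_tm K A is M) (map \<sigma> [0..<K]) n (map (override \<sigma> is ts') [0..<K])"
proof -
  \<comment> \<open>The embedded run is the run of \<open>M\<close> with its tapes written back into
    \<sigma>. Validity keeps the number of tapes constant, so that successive overrides collapse to
    the last one.\<close>
  have "(step (embed_tm K A is M) ^^ t) (start M, map \<sigma> [0..<K]) =
      map_prod id (\<lambda>ts. map (override \<sigma> is ts) [0..<K]) ((step M ^^ t) (start M, map \<sigma> is))" for t
  proof (induction t)
    case 0
    then show ?case using idx by simp
  next
    case (Suc t)
    obtain q ts where c: "(step M ^^ t) (start M, map \<sigma> is) = (q, ts)" by fastforce
    obtain q' ts' where c': "step M (q, ts) = (q', ts')" by fastforce
    have v: "valid_config M (q, ts)"
      using valid_config_funpow[OF wf valid_config_start[OF wf _ over]] idx c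
      by (metis length_map)
    then have l: "length ts = length is" using idx by (simp add: valid_config_def)
    have "valid_config M (q', ts')" using valid_config_step[OF wf v] c' by simp
    then have l': "length ts' = length is" using idx by (simp add: valid_config_def)
    have "step (embed_tm K A is M) (q, map (override \<sigma> is ts) [0..<K]) =
        (q', map (override (override \<sigma> is ts) is ts') [0..<K])"
      using step_embed_tm[OF wf idx, of q "override \<sigma> is ts" q' ts'] v c' l idx(1) by simp
    then show ?case using Suc c c' l l' idx(1) by simp
  qed
  then have "(step (embed_tm K A is M) ^^ n) (start M, map \<sigma> [0..<K]) = (halt M, map (override \<sigma> is ts') [0..<K])"
    using reaches_exact[OF run] by simp
  then show ?thesis by (intro reachesI) simp
qed

section \<open>Streaming transducers\<close>

text \<open>A transducer reads two words from left to right, each at its own pace, and emits at most one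
  letter per step. It starts in state 1 and stops in state 0; \<open>None\<close> signals the end of a word.\<close>

type_synonym transducer = "nat \<Rightarrow> bool option \<Rightarrow> bool option \<Rightarrow> nat \<times> bool \<times> bool \<times> bool option"

definition next_letter :: "word \<Rightarrow> bool option" where
  "next_letter u = (case u of [] \<Rightarrow> None | b # _ \<Rightarrow> Some b)"

lemma next_letter_simps [simp]: "next_letter [] = None" "next_letter (b # u) = Some b"
  by (simp_all add: next_letter_def)

text \<open>The components are the state, the two unread suffixes and the output so far. State 0 is
  a fixed point, like the halt state of a machine, and consuming from an exhausted word is harmless
  since \<open>tl [] = []\<close>.\<close>

fun tstep :: "transducer \<Rightarrow> nat \<times> word \<times> word \<times> word \<Rightarrow> nat \<times> word \<times> word \<times> word" where
  "tstep \<delta> (q, u, v, w) =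
     (if q = 0 then (q, u, v, w)
      else let (q', a, b, e) = \<delta> q (next_letter u) (next_letter v) in
        (q', if a then tl u else u, if b then tl v else v,
         w @ (case e of None \<Rightarrow> [] | Some l \<Rightarrow> [l])))"

text \<open>The bound \<open>N\<close> makes the set of states finite. The linear time bound also
  bounds the output length, since each step emits at most one letter.\<close>

definition transducible :: "(word \<Rightarrow> word \<Rightarrow> word) \<Rightarrow> bool" where
  "transducible T \<longleftrightarrow> (\<exists>\<delta> N C. 1 < N \<and> (\<forall>q a b. fst (\<delta> q a b) < N) \<and>
     (\<forall>u v. \<exists>t \<le> C * (length u + length v + 1). \<exists>u' v'.
        (tstep \<delta> ^^ t) (1, u, v, []) = (0, u', v', T u v)))"

section \<open>Simulation of transducers by three-tape machines\<close>

definition symbol_letter :: "nat \<Rightarrow> bool option" where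
  "symbol_letter a = (if a = blank then None else Some (a = letter True))"

text \<open>Tapes 0 and 1 are read, tape 2 is written. An input head never moves off a blank, which
  mirrors \<open>tl [] = []\<close> and keeps it from running past the end of its word.\<close>

definition transducer_tm :: "nat set \<Rightarrow> nat \<Rightarrow> transducer \<Rightarrow> tm" where
  "transducer_tm A N \<delta> = \<lparr> tapes = 3, states = {..<N}, alphabet = A, start = 1, halt = 0,
     trans = (\<lambda>q s. let (q', a, b, e) = \<delta> q (symbol_letter (s ! 0)) (symbol_letter (s ! 1)) in
       (q', [(s ! 0, if a \<and> s ! 0 \<noteq> blank then Right else Stay),
             (s ! 1, if b \<and> s ! 1 \<noteq> blank then Right else Stay),
             (case e of None \<Rightarrow> (s ! 2, Stay) | Some l \<Rightarrow> (letter l, Right))])) \<rparr>"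

lemma transducer_tm_simps [simp]:
  "tapes (transducer_tm A N \<delta>) = 3" "alphabet (transducer_tm A N \<delta>) = A"
  "start (transducer_tm A N \<delta>) = 1" "halt (transducer_tm A N \<delta>) = 0"
  by (simp_all add: transducer_tm_def)

lemma wf_transducer_tm:
  assumes "finite A" "{blank, letter False, letter True} \<subseteq> A" "1 < N" "\<And>q a b. fst (\<delta> q a b) < N"
  shows "wf_tm (transducer_tm A N \<delta>)"
proof -
  have "fst (trans (transducer_tm A N \<delta>) q s) < N \<and>
        length (snd (trans (transducer_tm A N \<delta>) q s)) = 3 \<and>
        fst ` set (snd (trans (transducer_tm A N \<delta>) q s)) \<subseteq> A"
    if s: "length s = 3" "set s \<subseteq> A" for q s
  proof -
    obtain q' a b e where d: "\<delta> q (symbol_letter (s ! 0)) (symbol_letter (s ! 1)) = (q', a, b, e)"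
      using prod_cases4 by blast
    have "q' < N" using assms(4) d by (metis fst_conv)
    moreover have "s ! 0 \<in> A" "s ! 1 \<in> A" "s ! 2 \<in> A" using s by (auto intro!: subsetD[OF s(2)])
    moreover have "letter l \<in> A" for l using assms(2) by (cases l) auto
    ultimately show ?thesis using d by (simp add: transducer_tm_def split: option.split)
  qed
  then show ?thesis
    using assms(1-3) by (auto simp: wf_tm_def transducer_tm_def)
qed

text \<open>The content of \<open>input_tape w\<close> without its head position, so that a
  partially written output tape and the blank tape have the same form.\<close>

definition cells :: "word \<Rightarrow> int \<Rightarrow> nat" where
  "cells w i = (if 0 \<le> i \<and> i < int (length w) then letter (w ! nat i) else blank)"

lemma input_tape_cells: "input_tape w = (0, cells w)"
  by (simp add: input_tape_def cells_def fun_eq_iff)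

lemma blank_tape_cells: "blank_tape = (0, cells [])"
  by (simp add: blank_tape_def cells_def fun_eq_iff)

lemma cells_snoc: "cells (w @ [b]) = (cells w)(int (length w) := letter b)"
  by (auto simp: cells_def fun_eq_iff nth_append)

lemma letter_neq_blank [simp]: "letter b \<noteq> blank"
  by (simp add: letter_def)

lemma symbol_letter_simps [simp]: "symbol_letter blank = None" "symbol_letter (letter b) = Some b"
  by (auto simp: symbol_letter_def letter_def)

lemma tape_word_Nil [simp]: "tape_word (p, c) [] \<longleftrightarrow> c p = blank"
  by simp

lemma tape_word_Cons: "tape_word (p, c) (b # u) \<longleftrightarrow> c p = letter b \<and> tape_word (p + 1, c) u"
  by (auto simp: All_less_Suc2 algebra_simps)

declare tape_word.simps [simp del]

lemma tape_word_next:
  "tape_word (p, c) u \<Longrightarrow> symbol_letter (c p) = next_letter u \<and> (c p = blank \<longleftrightarrow> u = [])"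
  by (cases u) (auto simp: tape_word_Cons)

lemma tape_word_tl: "tape_word (p, c) u \<Longrightarrow> u \<noteq> [] \<Longrightarrow> tape_word (p + 1, c) (tl u)"
  by (cases u) (auto simp: tape_word_Cons)

lemma tape_word_input_tape: "tape_word (0, cells w) w"
  by (simp add: tape_word.simps cells_def)

text \<open>The invariant: each input head stands at the first letter of the unread suffix and the
  output head just behind the output. The displacements \<open>m1\<close> and \<open>m2\<close>
  equal the numbers of letters consumed, which later bounds the cost of rewinding.\<close>

lemma step_transducer_tm:
  assumes "tape_word (p1, c1) u" "tape_word (p2, c2) v" "tstep \<delta> (q, u, v, w) = (q', u', v', w')"
  shows "\<exists>m1 m2. step (transducer_tm A N \<delta>) (q, [(p1, c1), (p2, c2), (int (length w), cells w)]) =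
      (q', [(p1 + int m1, c1), (p2 + int m2, c2), (int (length w'), cells w')]) \<and>
    tape_word (p1 + int m1, c1) u' \<and> tape_word (p2 + int m2, c2) v' \<and>
    m1 + length u' = length u \<and> m2 + length v' = length v \<and> length w' \<le> length w + 1"
proof (cases "q = 0")
  case True
  then show ?thesis
    using assms by (intro exI[of _ 0]) (simp add: step.simps)
next
  case False
  obtain r a b e where d: "\<delta> q (next_letter u) (next_letter v) = (r, a, b, e)"
    using prod_cases4 by blast
  have eq: "q' = r" "u' = (if a then tl u else u)" "v' = (if b then tl v else v)"
    "w' = w @ (case e of None \<Rightarrow> [] | Some l \<Rightarrow> [l])"
    using assms(3) False d by simp_all
  note n1 = tape_word_next[OF assms(1)] and n2 = tape_word_next[OF assms(2)]
  define m1 m2 :: nat where "m1 = (if a \<and> u \<noteq> [] then 1 else 0)" and "m2 = (if b \<and> v \<noteq> [] then 1 else 0)"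
  have "step (transducer_tm A N \<delta>) (q, [(p1, c1), (p2, c2), (int (length w), cells w)]) =
      (q', [(p1 + int m1, c1), (p2 + int m2, c2), (int (length w'), cells w')])"
    using False d n1 n2
    by (simp add: step.simps transducer_tm_def eq m1_def m2_def cells_snoc del: neq0_conv split: option.split)
  moreover have "tape_word (p1 + int m1, c1) u'" "tape_word (p2 + int m2, c2) v'"
    using assms(1,2) tape_word_tl by (auto simp: eq m1_def m2_def)
  moreover have "m1 + length u' = length u" "m2 + length v' = length v"
    by (cases u; simp add: eq m1_def) (cases v; simp add: eq m2_def)
  moreover have "length w' \<le> length w + 1"
    by (simp add: eq split: option.split)
  ultimately show ?thesis by blast
qed

lemma funpow_transducer_tm:
  assumes "tape_word (p1, c1) u" "tape_word (p2, c2) v" "(tstep \<delta> ^^ t) (q, u, v, []) = (q', u', v', w)"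
  shows "\<exists>m1 m2. (step (transducer_tm A N \<delta>) ^^ t) (q, [(p1, c1), (p2, c2), blank_tape]) =
      (q', [(p1 + int m1, c1), (p2 + int m2, c2), (int (length w), cells w)]) \<and>
    tape_word (p1 + int m1, c1) u' \<and> tape_word (p2 + int m2, c2) v' \<and>
    m1 + length u' = length u \<and> m2 + length v' = length v \<and> length w \<le> t"
  using assms(3)
proof (induction t arbitrary: q' u' v' w)
  case 0
  then show ?case
    using assms(1,2) by (intro exI[of _ 0]) (simp add: blank_tape_cells)
next
  case (Suc t)
  obtain r x y z where c: "(tstep \<delta> ^^ t) (q, u, v, []) = (r, x, y, z)"
    using prod_cases4 by blast
  obtain m1 m2 where *: "(step (transducer_tm A N \<delta>) ^^ t) (q, [(p1, c1), (p2, c2), blank_tape]) =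
      (r, [(p1 + int m1, c1), (p2 + int m2, c2), (int (length z), cells z)])"
    "tape_word (p1 + int m1, c1) x" "tape_word (p2 + int m2, c2) y"
    "m1 + length x = length u" "m2 + length y = length v" "length z \<le> t"
    using Suc.IH[OF c] by blast
  have "tstep \<delta> (r, x, y, z) = (q', u', v', w)"
    using Suc.prems c by (simp del: tstep.simps)
  from step_transducer_tm[OF *(2,3) this, of A N] obtain n1 n2 where
    "step (transducer_tm A N \<delta>) (r, [(p1 + int m1, c1), (p2 + int m2, c2), (int (length z), cells z)]) =
      (q', [(p1 + int m1 + int n1, c1), (p2 + int m2 + int n2, c2), (int (length w), cells w)])"
    "tape_word (p1 + int m1 + int n1, c1) u'" "tape_word (p2 + int m2 + int n2, c2) v'"
    "n1 + length u' = length x" "n2 + length v' = length y" "length w \<le> length z + 1" by blast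
  then show ?case
    using * by (intro exI[of _ "m1 + n1"] exI[of _ "m2 + n2"]) (simp add: add.assoc)
qed

section \<open>Rewinding a tape, alone and after a transducer\<close>

text \<open>The first step to the left is unconditional: the head may stand on the blank behind the
  word, which must not be mistaken for the one in front of it.\<close>

definition rewind_tm :: "nat set \<Rightarrow> tm" where
  "rewind_tm A = \<lparr> tapes = 1, states = {0, 1, 2}, alphabet = A, start = 0, halt = 2,
     trans = (\<lambda>q s. if q = 0 then (1, [(s ! 0, Left)])
       else if q = 1 \<and> s ! 0 \<noteq> blank then (1, [(s ! 0, Left)])
       else (2, [(s ! 0, Right)])) \<rparr>"

lemma rewind_tm_simps [simp]:
  "tapes (rewind_tm A) = 1" "alphabet (rewind_tm A) = A"
  by (simp_all add: rewind_tm_def)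

lemma wf_rewind_tm:
  assumes "finite A" "{blank, letter False, letter True} \<subseteq> A"
  shows "wf_tm (rewind_tm A)"
proof -
  have "s ! 0 \<in> A" if "length s = 1" "set s \<subseteq> A" for s
    using that by (cases s) auto
  then show ?thesis
    using assms by (auto simp: wf_tm_def rewind_tm_def)
qed

text \<open>There are \<open>n\<close> steps to the left over nonblank cells and one step to the
  right off the blank at \<open>p - 1\<close>.\<close>

lemma rewind_loop:
  assumes "c (p - 1) = blank" "\<And>i. i < n \<Longrightarrow> c (p + int i) \<noteq> blank"
  shows "(step (rewind_tm A) ^^ (n + 1)) (1, [(p - 1 + int n, c)]) = (2, [(p, c)])"
  using assms(2)
proof (induction n)
  case 0
  then show ?case using assms(1) by (simp add: step.simps rewind_tm_def fun_upd_idem)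
next
  case (Suc n)
  have "step (rewind_tm A) (1, [(p - 1 + int (Suc n), c)]) = (1, [(p - 1 + int n, c)])"
    using Suc.prems[of n] by (simp add: step.simps rewind_tm_def)
  then show ?case
    using Suc by (simp only: add_Suc funpow_Suc_right o_apply) simp
qed

lemma reaches_rewind_tm:
  assumes "c (p - 1) = blank" "\<And>i. i < n \<Longrightarrow> c (p + int i) \<noteq> blank"
  shows "reaches (rewind_tm A) [(p + int n, c)] (n + 2) [(p, c)]"
proof (rule reachesI)
  have "step (rewind_tm A) (0, [(p + int n, c)]) = (1, [(p - 1 + int n, c)])"
    by (simp add: step.simps rewind_tm_def)
  then have "(step (rewind_tm A) ^^ Suc (n + 1)) (0, [(p + int n, c)]) = (2, [(p, c)])"
    using rewind_loop[OF assms] by (simp only: funpow_Suc_right o_apply)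
  then show "(step (rewind_tm A) ^^ (n + 2)) (start (rewind_tm A), [(p + int n, c)]) = (halt (rewind_tm A), [(p, c)])"
    by (simp add: rewind_tm_def)
qed

lemma range_cells: "{blank, letter False, letter True} \<subseteq> A \<Longrightarrow> range (cells w) \<subseteq> A"
proof -
  assume A: "{blank, letter False, letter True} \<subseteq> A"
  have "letter b \<in> A" for b using A by (cases b) auto
  then show ?thesis using A by (auto simp: cells_def)
qed

text \<open>The condition \<open>n \<le> length w\<close> covers a head just behind a freshly
  written word as well as one that stopped inside the word.\<close>

lemma reaches_rewind_embedded:
  assumes "k < K" "\<sigma> k = (int n, cells w)" "n \<le> length w" "finite A"
    "{blank, letter False, letter True} \<subseteq> A"
  shows "reaches (embed_tm K A [k] (rewind_tm A)) (map \<sigma> [0..<K]) (n + 2) (map (\<sigma>(k := input_tape w)) [0..<K])"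
proof -
  have "reaches (rewind_tm A) (map \<sigma> [k]) (n + 2) [input_tape w]"
    using reaches_rewind_tm[of "cells w" 0 n A] assms(2,3) by (simp add: input_tape_cells cells_def)
  moreover have "override \<sigma> [k] [input_tape w] = \<sigma>(k := input_tape w)"
    by (auto simp: override_def fun_eq_iff)
  ultimately show ?thesis
    using reaches_embed_tm[OF wf_rewind_tm[OF assms(4,5)], of "[k]" K \<sigma> "n + 2" "[input_tape w]" A]
      assms(1,2) range_cells[OF assms(5)]
    by (simp add: tapes_over_def)
qed

text \<open>Only the output tape \<open>k\<close> is rewound, which turns it into an input tape for
  a later machine; the heads on \<open>i\<close> and \<open>j\<close> stay where the transducer left
  them.\<close>

definition stream_tm :: "nat \<Rightarrow> nat set \<Rightarrow> nat \<Rightarrow> transducer \<Rightarrow> nat \<Rightarrow> nat \<Rightarrow> nat \<Rightarrow> tm" where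
  "stream_tm K A N \<delta> i j k =
     seq_tm (embed_tm K A [i, j, k] (transducer_tm A N \<delta>)) (embed_tm K A [k] (rewind_tm A))"

lemma stream_tm_simps [simp]:
  "tapes (stream_tm K A N \<delta> i j k) = K" "alphabet (stream_tm K A N \<delta> i j k) = A"
  by (simp_all add: stream_tm_def)

lemma wf_stream_tm:
  assumes "finite A" "{blank, letter False, letter True} \<subseteq> A" "1 < N" "\<And>q a b. fst (\<delta> q a b) < N"
    "distinct [i, j, k]" "i < K" "j < K" "k < K"
  shows "wf_tm (stream_tm K A N \<delta> i j k)"
  unfolding stream_tm_def
  using assms by (intro wf_seq_tm wf_embed_tm wf_transducer_tm wf_rewind_tm) simp_all

lemma reaches_stream_tm:
  assumes A: "finite A" "{blank, letter False, letter True} \<subseteq> A" and N: "1 < N" "\<And>q a b. fst (\<delta> q a b) < N"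
    and ijk: "distinct [i, j, k]" "i < K" "j < K" "k < K"
    and run: "(tstep \<delta> ^^ t) (1, u, v, []) = (0, u', v', w)"
    and \<sigma>: "\<sigma> i = (p1, c1)" "tape_word (p1, c1) u" "range c1 \<subseteq> A"
      "\<sigma> j = (p2, c2)" "tape_word (p2, c2) v" "range c2 \<subseteq> A" "\<sigma> k = blank_tape"
  shows "length w \<le> t \<and> (\<exists>m1 m2. m1 \<le> length u \<and> m2 \<le> length v \<and>
    reaches (stream_tm K A N \<delta> i j k) (map \<sigma> [0..<K]) (2 * t + 3)
      (map (\<sigma>(i := (p1 + int m1, c1), j := (p2 + int m2, c2), k := input_tape w)) [0..<K]))"
proof -
  obtain m1 m2 where m: "(step (transducer_tm A N \<delta>) ^^ t) (1, [(p1, c1), (p2, c2), blank_tape]) =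
      (0, [(p1 + int m1, c1), (p2 + int m2, c2), (int (length w), cells w)])"
    "m1 + length u' = length u" "m2 + length v' = length v" "length w \<le> t"
    using funpow_transducer_tm[OF \<sigma>(2,5) run, of A N] by blast
  let ?ts = "[(p1 + int m1, c1), (p2 + int m2, c2), (int (length w), cells w)]"
  let ?\<sigma> = "\<sigma>(i := (p1 + int m1, c1), j := (p2 + int m2, c2), k := (int (length w), cells w))"
  have "reaches (transducer_tm A N \<delta>) (map \<sigma> [i, j, k]) t ?ts"
    using m(1) \<sigma> by (intro reachesI) simp
  moreover have "tapes_over A (map \<sigma> [i, j, k])"
    using \<sigma> A(2) by (auto simp: tapes_over_def blank_tape_def)
  moreover have "override \<sigma> [i, j, k] ?ts = ?\<sigma>"
    using ijk(1) by (auto simp: override_def fun_eq_iff)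
  ultimately have "reaches (embed_tm K A [i, j, k] (transducer_tm A N \<delta>)) (map \<sigma> [0..<K]) t (map ?\<sigma> [0..<K])"
    using reaches_embed_tm[OF wf_transducer_tm[where \<delta> = \<delta>, OF A N], of "[i, j, k]" K \<sigma> t ?ts A] ijk by simp
  moreover have "reaches (embed_tm K A [k] (rewind_tm A)) (map ?\<sigma> [0..<K]) (length w + 2)
      (map (?\<sigma>(k := input_tape w)) [0..<K])"
    using ijk A by (intro reaches_rewind_embedded) simp_all
  ultimately have "reaches (stream_tm K A N \<delta> i j k) (map \<sigma> [0..<K]) (t + (length w + 2) + 1)
      (map (?\<sigma>(k := input_tape w)) [0..<K])"
    unfolding stream_tm_def by (rule reaches_seq_tm)
  \<comment> \<open>The transducer, the rewinding and the linking step take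
    \<open>t + (length w + 2) + 1\<close> steps, and \<open>length w \<le> t\<close>.\<close>
  then have "reaches (stream_tm K A N \<delta> i j k) (map \<sigma> [0..<K]) (2 * t + 3)
      (map (\<sigma>(i := (p1 + int m1, c1), j := (p2 + int m2, c2), k := input_tape w)) [0..<K])"
    using m(4) by (auto elim!: reaches_mono)
  then show ?thesis using m(2-4) by (metis le_add1)
qed

section \<open>Length of outputs\<close>

text \<open>A head moves at most one cell per step and writes only where it stands, so after
  \<open>t\<close> steps everything happens within distance \<open>t\<close> of the origin or on the
  input.\<close>

lemma funpow_step_support:
  assumes "(step M ^^ t) (initial M x) = (q, ts)" "tp \<in> set ts"
  shows "\<bar>fst tp\<bar> \<le> int t \<and> (\<forall>i. snd tp i \<noteq> blank \<longrightarrow> - int t \<le> i \<and> i \<le> int (length x) + int t)"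
  using assms
proof (induction t arbitrary: q ts tp)
  case 0
  then have "tp = input_tape x \<or> tp = blank_tape"
    by (auto simp: initial_def split: if_splits)
  then show ?case by (auto simp: input_tape_def blank_tape_def split: if_splits)
next
  case (Suc t)
  obtain r us where c: "(step M ^^ t) (initial M x) = (r, us)" by fastforce
  have "ts = us \<or> (\<exists>as. ts = map2 act as us)"
    using Suc.prems(1) c by (auto simp: step.simps split: if_splits prod.splits)
  then have "\<exists>a up. up \<in> set us \<and> (tp = up \<or> tp = act a up)"
  proof
    assume "\<exists>as. ts = map2 act as us"
    then obtain as i where "i < length us" "tp = act (as ! i) (us ! i)"
      using Suc.prems(2) by (auto simp: in_set_conv_nth)
    then show ?thesis using nth_mem by blast
  qed (use Suc.prems(2) in blast)
  then obtain a up where up: "up \<in> set us" "tp = up \<or> tp = act a up" by blast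
  obtain p d where pd: "up = (p, d)" by fastforce
  obtain b m where a: "a = (b, m)" by fastforce
  have sh: "\<bar>shift m\<bar> \<le> 1" by (cases m) auto
  have IH: "\<bar>p\<bar> \<le> int t" "\<And>i. d i \<noteq> blank \<Longrightarrow> - int t \<le> i \<and> i \<le> int (length x) + int t"
    using Suc.IH[OF c up(1)] by (auto simp: pd)
  show ?case
    using up(2)
  proof
    assume tp: "tp = up"
    have "- int (Suc t) \<le> i \<and> i \<le> int (length x) + int (Suc t)" if "snd tp i \<noteq> blank" for i
      using that IH(2)[of i] by (simp add: tp pd)
    then show ?thesis using IH(1) by (simp add: tp pd)
  next
    assume tp: "tp = act a up"
    have "- int (Suc t) \<le> i \<and> i \<le> int (length x) + int (Suc t)" if "snd tp i \<noteq> blank" for i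
      using that IH(1) IH(2)[of i] by (cases "i = p") (auto simp: tp pd a)
    moreover have "\<bar>fst tp\<bar> \<le> int (Suc t)" using IH(1) sh by (auto simp: tp pd a)
    ultimately show ?thesis by blast
  qed
qed

text \<open>The output starts at a head position not below \<open>- t\<close>, and its last letter
  lies on a nonblank cell not beyond \<open>length x + t\<close>. This makes the outputs of
  \<open>FP\<close> functions polynomially long, as composition requires.\<close>

lemma outputs_within_length:
  assumes "wf_tm M" "outputs_within M x w t"
  shows "length w \<le> length x + 2 * t + 1"
proof (cases "w = []")
  case False
  obtain ts where ts: "(step M ^^ t) (initial M x) = (halt M, ts)" "tape_word (last ts) w"
    using assms(2) by (auto simp: outputs_within_def)
  have "valid_config M (initial M x)"
    using assms(1) range_cells[of "alphabet M" x] unfolding initial_def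
    by (intro valid_config_start)
      (auto simp: wf_tm_def tapes_over_def input_tape_cells blank_tape_def split: if_splits)
  then have "length ts = tapes M"
    using valid_config_funpow[OF assms(1)] ts(1) by (metis snd_conv valid_config_def)
  then have "last ts \<in> set ts" using assms(1) by (cases ts) (auto simp: wf_tm_def)
  note supp = funpow_step_support[OF ts(1) this]
  obtain p c where l: "last ts = (p, c)" by fastforce
  have "c (p + int (length w - 1)) \<noteq> blank"
    using ts(2) False by (simp add: l tape_word.simps)
  then have "p + int (length w - 1) \<le> int (length x) + int t" "- int t \<le> p"
    using supp by (auto simp: l)
  then show ?thesis by linarith
qed simp

section \<open>Concrete transducers\<close>

definition treaches :: "transducer \<Rightarrow> nat \<Rightarrow> nat \<times> word \<times> word \<times> word \<Rightarrow> word \<Rightarrow> bool" where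
  "treaches \<delta> n c w \<longleftrightarrow> (\<exists>t\<le>n. \<exists>u v. (tstep \<delta> ^^ t) c = (0, u, v, w))"

lemma treaches_halt: "treaches \<delta> n (0, u, v, w) w"
  unfolding treaches_def by (intro exI[of _ 0]) simp

lemma treaches_step: "treaches \<delta> n (tstep \<delta> c) w \<Longrightarrow> treaches \<delta> (Suc n) c w"
  unfolding treaches_def by (metis Suc_le_mono funpow_Suc_right o_apply)

lemma treaches_step2: "treaches \<delta> n (tstep \<delta> (tstep \<delta> c)) w \<Longrightarrow> treaches \<delta> (n + 2) c w"
  by (simp add: treaches_step del: tstep.simps)

lemma treaches_mono: "treaches \<delta> n c w \<Longrightarrow> n \<le> m \<Longrightarrow> treaches \<delta> m c w"
  unfolding treaches_def by (meson le_trans)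

lemma transducibleI:
  assumes "1 < N" "\<And>q a b. fst (\<delta> q a b) < N"
    "\<And>u v. treaches \<delta> (C * (length u + length v + 1)) (1, u, v, []) (T u v)"
  shows "transducible T"
  using assms unfolding transducible_def treaches_def by blast

section \<open>Copying and pairing\<close>

definition copy_trd :: transducer where
  "copy_trd q a b = (case a of None \<Rightarrow> (0, False, False, None) | Some l \<Rightarrow> (1, True, False, Some l))"

lemma treaches_copy: "treaches copy_trd (Suc (length u)) (1, u, v, w) (w @ u)"
proof (induction u arbitrary: w)
  case Nil
  show ?case
    by (rule treaches_step) (simp add: copy_trd_def treaches_halt)
next
  case (Cons a u)
  show ?case
    using Cons.IH[of "w @ [a]"] by - (rule treaches_step, simp add: copy_trd_def)
qed

lemma transducible_copy: "transducible (\<lambda>u v. u)"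
proof (rule transducibleI[where N = 2 and \<delta> = copy_trd and C = 1])
  show "treaches copy_trd (1 * (length u + length v + 1)) (1, u, v, []) u" for u v
    using treaches_copy[of u v "[]"] by (auto elim!: treaches_mono)
qed (auto simp: copy_trd_def split: option.split)

text \<open>States 1 and 2 encode the first word: 1 emits the marker, or the terminator at the end,
  and 2 emits the letter itself. State 3 copies the second word.\<close>

definition pair_trd :: transducer where
  "pair_trd q a b =
     (if q = 1 then
        (case a of None \<Rightarrow> (3, False, False, Some False) | Some l \<Rightarrow> (2, False, False, Some True))
      else if q = 2 then (1, True, False, a)
      else (case b of None \<Rightarrow> (0, False, False, None) | Some l \<Rightarrow> (3, False, True, Some l)))"

lemma treaches_pair_snd: "treaches pair_trd (Suc (length v)) (3, u, v, w) (w @ v)"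
proof (induction v arbitrary: w)
  case Nil
  show ?case
    by (rule treaches_step) (simp add: pair_trd_def treaches_halt)
next
  case (Cons a v)
  show ?case
    using Cons.IH[of "w @ [a]"] by - (rule treaches_step, simp add: pair_trd_def)
qed

lemma enc_word_simps [simp]:
  "enc_word [] = [False]" "enc_word (b # u) = True # b # enc_word u"
  by (simp_all add: enc_word_def)

lemma treaches_pair: "treaches pair_trd (2 * length u + length v + 2) (1, u, v, w) (w @ enc_word u @ v)"
proof (induction u arbitrary: w)
  case Nil
  show ?case
  proof -
    have "tstep pair_trd (1, [], v, w) = (3, [], v, w @ [False])" by (simp add: pair_trd_def)
    then show ?thesis
      using treaches_step[of pair_trd "Suc (length v)" "(1, [], v, w)"] treaches_pair_snd[of v "[]" "w @ [False]"]
      by (simp del: tstep.simps)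
  qed
next
  case (Cons a u)
  show ?case
  proof -
    have "tstep pair_trd (tstep pair_trd (1, a # u, v, w)) = (1, u, v, w @ [True, a])"
      by (simp add: pair_trd_def)
    then show ?thesis
      using treaches_step2[of pair_trd "2 * length u + length v + 2" "(1, a # u, v, w)"] Cons.IH[of "w @ [True, a]"]
      by (simp del: tstep.simps)
  qed
qed

lemma transducible_pair: "transducible (\<lambda>u v. enc_word u @ v)"
proof (rule transducibleI[where N = 4 and \<delta> = pair_trd and C = 2])
  show "treaches pair_trd (2 * (length u + length v + 1)) (1, u, v, []) (enc_word u @ v)" for u v
    using treaches_pair[of u v "[]"] by (auto elim!: treaches_mono)
qed (auto simp: pair_trd_def split: option.split)

section \<open>Decoding of pairs and branching\<close>

text \<open>On a tuple this yields the first component. The values on malformed words are chosen to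
  agree with what the transducer below emits on them.\<close>

fun dec_fst :: "word \<Rightarrow> word" where
  "dec_fst (True # b # r) = b # dec_fst r"
| "dec_fst _ = []"

fun dec_snd :: "word \<Rightarrow> word" where
  "dec_snd (True # b # r) = dec_snd r"
| "dec_snd (False # r) = r"
| "dec_snd _ = []"

lemma dec_fst_enc [simp]: "dec_fst (enc_word u @ v) = u"
  by (induction u) simp_all

lemma dec_snd_enc [simp]: "dec_snd (enc_word u @ v) = v"
  by (induction u) simp_all

text \<open>State 1 tests the second word for emptiness. States 2 and 3 read marker and letter of
  the first component and emit the letter; 4 and 5 skip that component, and 6 copies the
  remainder.\<close>

definition cond_trd :: transducer where
  "cond_trd q a b =
     (if q = 1 then (if b = None then 4 else 2, False, False, None)
      else if q = 2 then (if a = Some True then (3, True, False, None) else (0, False, False, None))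
      else if q = 3 then (if a = None then 0 else 2, True, False, a)
      else if q = 4 then (if a = None then 0 else if a = Some True then 5 else 6, True, False, None)
      else if q = 5 then (if a = None then 0 else 4, True, False, None)
      else (if a = None then 0 else 6, True, False, a))"

lemma treaches_cond_fst: "treaches cond_trd (Suc (length u)) (2, u, v, w) (w @ dec_fst u)"
proof (induction u arbitrary: w rule: dec_fst.induct)
  case (1 b r)
  show ?case
  proof -
    have "tstep cond_trd (tstep cond_trd (2, True # b # r, v, w)) = (2, r, v, w @ [b])"
      by (simp add: cond_trd_def)
    then show ?thesis
      using treaches_step2[of cond_trd "Suc (length r)" "(2, True # b # r, v, w)"] 1[of "w @ [b]"]
      by (simp del: tstep.simps)
  qed
qed (auto intro!: treaches_step treaches_halt simp: cond_trd_def)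

lemma treaches_cond_copy: "treaches cond_trd (Suc (length u)) (6, u, v, w) (w @ u)"
proof (induction u arbitrary: w)
  case Nil
  show ?case
    by (rule treaches_step) (simp add: cond_trd_def treaches_halt)
next
  case (Cons a u)
  show ?case
    using Cons.IH[of "w @ [a]"] by - (rule treaches_step, simp add: cond_trd_def)
qed

lemma treaches_cond_snd: "treaches cond_trd (Suc (length u)) (4, u, v, w) (w @ dec_snd u)"
proof (induction u rule: dec_snd.induct)
  case (1 b r)
  have "tstep cond_trd (tstep cond_trd (4, True # b # r, v, w)) = (4, r, v, w)"
    by (simp add: cond_trd_def)
  then show ?case
    using treaches_step2[of cond_trd "Suc (length r)" "(4, True # b # r, v, w)"] 1 by (simp del: tstep.simps)
next
  case (2 r)
  show ?case
  proof -
    have "tstep cond_trd (4, False # r, v, w) = (6, r, v, w)" by (simp add: cond_trd_def)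
    then show ?thesis
      using treaches_step[of cond_trd "Suc (length r)" "(4, False # r, v, w)"] treaches_cond_copy[of r v w]
      by (simp del: tstep.simps)
  qed
qed (auto intro!: treaches_step treaches_halt simp: cond_trd_def)

text \<open>The empty word plays the role of false. Branching comes from a varying \<open>v\<close>,
  and the two decoding functions from a \<open>v\<close> that is always nonempty or always
  empty.\<close>

lemma transducible_cond: "transducible (\<lambda>u v. if v = [] then dec_snd u else dec_fst u)"
proof (rule transducibleI[where N = 7 and \<delta> = cond_trd and C = 2])
  show "treaches cond_trd (2 * (length u + length v + 1)) (1, u, v, []) (if v = [] then dec_snd u else dec_fst u)"
    for u v
  proof -
    have "treaches cond_trd (Suc (Suc (length u))) (1, u, v, []) (if v = [] then dec_snd u else dec_fst u)"
      using treaches_cond_fst[of u v "[]"] treaches_cond_snd[of u v "[]"]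
      by - (rule treaches_step, cases v, simp_all add: cond_trd_def)
    then show ?thesis by (rule treaches_mono) simp
  qed
qed (auto simp: cond_trd_def)

text \<open>States 1, 2 and 3 record that the prefixes read so far are equal, in increasing and in
  decreasing dictionary order, respectively.\<close>

definition less_trd :: transducer where
  "less_trd q a b = (case (a, b) of
       (Some x, Some y) \<Rightarrow>
         (if q = 1 then (if x = y then 1 else if y then 2 else 3) else if q = 2 then 2 else 3,
          True, True, None)
     | (None, Some y) \<Rightarrow> (0, False, False, Some True)
     | (Some x, None) \<Rightarrow> (0, False, False, None)
     | (None, None) \<Rightarrow> (0, False, False, if q = 2 then Some True else None))"

text \<open>The word that ends first is the shorter one and decides the comparison; the dictionary
  order recorded in the state counts only if both end together. The induction needs all three
  recording states.\<close>

lemma treaches_less: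
  "q \<in> {1, 2, 3} \<Longrightarrow> treaches less_trd (Suc (length u)) (q, u, v, [])
     (if length u < length v \<or> length u = length v \<and> (q = 2 \<or> q = 1 \<and> (u, v) \<in> lex {(False, True)})
      then [True] else [])"
proof (induction u arbitrary: q v)
  case Nil
  then show ?case
    by (cases v) (auto intro!: treaches_step treaches_halt simp: less_trd_def)
next
  case (Cons x u)
  show ?case
  proof (cases v)
    case Nil
    then show ?thesis using Cons.prems
      by (auto intro!: treaches_step treaches_halt simp: less_trd_def)
  next
    case v: (Cons y v')
    define q' :: nat where "q' = (if q = 1 then (if x = y then 1 else if y then 2 else 3) else if q = 2 then 2 else 3)"
    have "tstep less_trd (q, x # u, v, []) = (q', u, v', [])"
      using Cons.prems by (auto simp: less_trd_def v q'_def)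
    moreover have "(length u < length v' \<or> length u = length v' \<and> (q' = 2 \<or> q' = 1 \<and> (u, v') \<in> lex {(False, True)})) =
      (length (x # u) < length v \<or> length (x # u) = length v \<and> (q = 2 \<or> q = 1 \<and> (x # u, v) \<in> lex {(False, True)}))"
      using Cons.prems by (auto simp: v q'_def)
    moreover have "q' \<in> {1, 2, 3}" by (simp add: q'_def)
    ultimately show ?thesis
      using Cons.IH[of q' v'] treaches_step[of less_trd "Suc (length u)" "(q, x # u, v, [])"] by simp
  qed
qed

lemma transducible_less: "transducible (\<lambda>u v. if u <\<^sub>l\<^sub>e\<^sub>x v then [True] else [])"
proof (rule transducibleI[where N = 4 and \<delta> = less_trd and C = 1])
  show "treaches less_trd (1 * (length u + length v + 1)) (1, u, v, []) (if u <\<^sub>l\<^sub>e\<^sub>x v then [True] else [])" for u v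
  proof (rule treaches_mono)
    show "treaches less_trd (Suc (length u)) (1, u, v, []) (if u <\<^sub>l\<^sub>e\<^sub>x v then [True] else [])"
      using treaches_less[of 1 u v] by (simp add: lex_less_def lenlex_conv)
  qed simp
qed (auto simp: less_trd_def split: option.split)

section \<open>Closure properties of \<open>FP\<close>\<close>

definition poly_bounded :: "(word \<Rightarrow> nat) \<Rightarrow> bool" where
  "poly_bounded h \<longleftrightarrow> (\<exists>p :: nat poly. \<forall>x. h x \<le> poly p (length x))"

text \<open>Coefficients in \<open>nat\<close> are nonnegative. Monotonicity allows a length bound
  to be substituted into a running time.\<close>

lemma poly_nat_mono: "a \<le> b \<Longrightarrow> poly (p :: nat poly) a \<le> poly p b"
  by (induction p) (auto intro: mult_mono)

lemma poly_bounded_poly: "poly_bounded (\<lambda>x. poly p (length x))"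
  unfolding poly_bounded_def by blast

lemma poly_bounded_const: "poly_bounded (\<lambda>x. n)"
  unfolding poly_bounded_def by (intro exI[of _ "[:n:]"]) simp

lemma poly_bounded_length: "poly_bounded length"
  unfolding poly_bounded_def by (intro exI[of _ "[:0, 1:]"]) simp

lemma poly_bounded_add: "poly_bounded g \<Longrightarrow> poly_bounded h \<Longrightarrow> poly_bounded (\<lambda>x. g x + h x)"
  unfolding poly_bounded_def by (metis add_mono poly_add)

lemma poly_bounded_mult: "poly_bounded g \<Longrightarrow> poly_bounded h \<Longrightarrow> poly_bounded (\<lambda>x. g x * h x)"
  unfolding poly_bounded_def by (metis mult_mono poly_mult zero_le)

lemma poly_bounded_compose:
  assumes "poly_bounded h" shows "poly_bounded (\<lambda>x. poly p (h x))"
proof -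
  obtain r :: "nat poly" where "\<And>x. h x \<le> poly r (length x)"
    using assms unfolding poly_bounded_def by blast
  then have "poly p (h x) \<le> poly (p \<circ>\<^sub>p r) (length x)" for x
    by (simp add: poly_pcompose poly_nat_mono)
  then show ?thesis unfolding poly_bounded_def by blast
qed

lemmas poly_bounded_intros = poly_bounded_poly poly_bounded_const poly_bounded_length
  poly_bounded_add poly_bounded_mult poly_bounded_compose

lemma outputs_within_iff:
  "outputs_within M x w t \<longleftrightarrow> (\<exists>ts. reaches M (snd (initial M x)) t ts \<and> tape_word (last ts) w)"
  unfolding outputs_within_def by (metis reaches_exact reachesI initial_def snd_conv)

lemma FP_I:
  assumes "wf_tm M" "poly_bounded h" "\<And>x. outputs_within M x (f x) (h x)"
  shows "f \<in> FP"
proof -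
  obtain p :: "nat poly" where p: "\<And>x. h x \<le> poly p (length x)"
    using assms(2) unfolding poly_bounded_def by blast
  then have "outputs_within M x (f x) (poly p (length x))" for x
    using assms(3) reaches_mono unfolding outputs_within_iff by blast
  then show ?thesis using assms(1) unfolding FP_def by blast
qed

section \<open>The six-phase machine that transduces two \<open>FP\<close> functions\<close>

lemma map_initial:
  assumes "wf_tm M" "\<sigma> b = input_tape x" "\<And>j. b < j \<Longrightarrow> j < b + tapes M \<Longrightarrow> \<sigma> j = blank_tape"
  shows "map \<sigma> [b..<b + tapes M] = snd (initial M x)"
proof -
  obtain k where k: "tapes M = Suc k" using assms(1) by (cases "tapes M") (auto simp: wf_tm_def)
  have "[b..<b + tapes M] = b # [Suc b..<Suc b + k]"
    by (simp add: k upt_conv_Cons)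
  moreover have "map \<sigma> [Suc b..<Suc b + k] = replicate k blank_tape"
    using assms(3) k by (intro nth_equalityI) (simp_all del: upt_Suc)
  ultimately show ?thesis
    using assms(2) by (simp add: initial_def k)
qed

lemma tapes_over_initial:
  assumes "{blank, letter False, letter True} \<subseteq> A"
  shows "tapes_over A (snd (initial M x))"
  using assms range_cells[OF assms, of x]
  by (auto simp: tapes_over_def initial_def input_tape_cells blank_tape_def split: if_splits)

text \<open>The first machine works directly on the input, a copy of which is made for the second one;
  the transducer feeds the third machine.\<close>

lemma FP_transduce:
  assumes T: "transducible T" and f1: "f1 \<in> FP" and f2: "f2 \<in> FP" and f3: "f3 \<in> FP"
  shows "(\<lambda>x. f3 (T (f1 x) (f2 x))) \<in> FP"
proof -
  obtain M1 p1 where M1: "wf_tm M1" "\<And>x. outputs_within M1 x (f1 x) (poly p1 (length x))"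
    using f1 unfolding FP_def by blast
  obtain M2 p2 where M2: "wf_tm M2" "\<And>x. outputs_within M2 x (f2 x) (poly p2 (length x))"
    using f2 unfolding FP_def by blast
  obtain M3 p3 where M3: "wf_tm M3" "\<And>x. outputs_within M3 x (f3 x) (poly p3 (length x))"
    using f3 unfolding FP_def by blast
  obtain \<delta> N C where \<delta>: "1 < N" "\<And>q a b. fst (\<delta> q a b) < N"
    "\<And>u v. \<exists>t \<le> C * (length u + length v + 1). \<exists>u' v'. (tstep \<delta> ^^ t) (1, u, v, []) = (0, u', v', T u v)"
    using T unfolding transducible_def by blast
  obtain \<delta>' N' C' where \<delta>': "1 < N'" "\<And>q a b. fst (\<delta>' q a b) < N'"
    "\<And>u v. \<exists>t \<le> C' * (length u + length v + 1). \<exists>u' v'. (tstep \<delta>' ^^ t) (1, u, v, []) = (0, u', v', u)"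
    using transducible_copy unfolding transducible_def by blast
  define A where "A = alphabet M1 \<union> alphabet M2 \<union> alphabet M3"
  \<comment> \<open>The tapes form three consecutive blocks for \<open>M1\<close>, \<open>M2\<close>
    and \<open>M3\<close>, starting at 0, \<open>b2\<close> and \<open>b3\<close>. The first tape of
    a block is the input tape of its machine and the last one its output tape.\<close>
  define b2 where "b2 = tapes M1"
  define b3 where "b3 = b2 + tapes M2"
  define K where "K = b3 + tapes M3"
  have A: "finite A" "{blank, letter False, letter True} \<subseteq> A"
    "alphabet M1 \<subseteq> A" "alphabet M2 \<subseteq> A" "alphabet M3 \<subseteq> A"
    using M1(1) M2(1) M3(1) by (auto simp: A_def wf_tm_def)
  have al: "{blank, letter False, letter True} \<subseteq> alphabet M1"
    "{blank, letter False, letter True} \<subseteq> alphabet M2" "{blank, letter False, letter True} \<subseteq> alphabet M3"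
    using M1(1) M2(1) M3(1) by (auto simp: wf_tm_def)
  have b: "0 < b2" "b2 < b3" "b3 < K"
    using M1(1) M2(1) M3(1) by (auto simp: b2_def b3_def K_def wf_tm_def)
  \<comment> \<open>\<open>P1\<close> copies the input from tape 0 to tape \<open>b2\<close>, with
    the still blank tape \<open>b3\<close> as empty second input. \<open>P2\<close> then rewinds
    tape 0.\<close>
  define P1 where "P1 = stream_tm K A N' \<delta>' 0 b3 b2"
  define P2 where "P2 = embed_tm K A [0] (rewind_tm A)"
  define P3 where "P3 = embed_tm K A [0..<b2] M1"
  define P4 where "P4 = embed_tm K A [b2..<b3] M2"
  \<comment> \<open>The transducer reads the output tapes of \<open>M1\<close> and \<open>M2\<close>
    and writes on the input tape of \<open>M3\<close>.\<close>
  define P5 where "P5 = stream_tm K A N \<delta> (b2 - 1) (b3 - 1) b3"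
  define P6 where "P6 = embed_tm K A [b3..<K] M3"
  define M where "M = seq_tm P1 (seq_tm P2 (seq_tm P3 (seq_tm P4 (seq_tm P5 P6))))"
  have simps: "tapes P1 = K" "tapes P2 = K" "tapes P3 = K" "tapes P4 = K" "tapes P5 = K" "tapes P6 = K"
    "alphabet P1 = A" "alphabet P2 = A" "alphabet P3 = A" "alphabet P4 = A" "alphabet P5 = A" "alphabet P6 = A"
    by (simp_all add: P1_def P2_def P3_def P4_def P5_def P6_def)
  have "wf_tm P1" unfolding P1_def
    using A \<delta>' b by (intro wf_stream_tm) auto
  moreover have "wf_tm P2" unfolding P2_def
    using A b by (intro wf_embed_tm wf_rewind_tm) auto
  moreover have "wf_tm P3" unfolding P3_def
    using A b M1 by (intro wf_embed_tm) (auto simp: b2_def)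
  moreover have "wf_tm P4" unfolding P4_def
    using A b M2 by (intro wf_embed_tm) (auto simp: b3_def)
  moreover have "wf_tm P5" unfolding P5_def
    using A \<delta> b by (intro wf_stream_tm) auto
  moreover have "wf_tm P6" unfolding P6_def
    using A b M3 by (intro wf_embed_tm) (auto simp: K_def)
  ultimately have wf: "wf_tm M"
    unfolding M_def by (intro wf_seq_tm) (simp_all add: simps)
  have tapes_M: "tapes M = K" by (simp add: M_def simps)

  \<comment> \<open>\<open>len1\<close> and \<open>len2\<close> bound the outputs of
    \<open>M1\<close> and \<open>M2\<close>, and \<open>n1\<close> to \<open>n6\<close> the times of
    the six phases. Each \<open>+ 1\<close> in the sum \<open>n\<close> is a linking step.\<close>
  define len1 where "len1 x = length x + 2 * poly p1 (length x) + 1" for x :: word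
  define len2 where "len2 x = length x + 2 * poly p2 (length x) + 1" for x :: word
  define n1 where "n1 x = 2 * (C' * (length x + 1)) + 3" for x :: word
  define n2 where "n2 x = length x + 2" for x :: word
  define n3 where "n3 x = poly p1 (length x)" for x :: word
  define n4 where "n4 x = poly p2 (length x)" for x :: word
  define n5 where "n5 x = 2 * (C * (len1 x + len2 x + 1)) + 3" for x
  define n6 where "n6 x = poly p3 (C * (len1 x + len2 x + 1))" for x
  define n where "n x = n1 x + (n2 x + (n3 x + (n4 x + (n5 x + n6 x + 1) + 1) + 1) + 1) + 1" for x
  have n: "poly_bounded n"
    unfolding n_def n1_def n2_def n3_def n4_def n5_def n6_def len1_def len2_def
    by (intro poly_bounded_intros)

  have "outputs_within M x (f3 (T (f1 x) (f2 x))) (n x)" for x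
  proof -
    define \<sigma>0 where "\<sigma>0 j = (if j = 0 then input_tape x else blank_tape)" for j :: nat
    define \<sigma>2 where "\<sigma>2 = \<sigma>0(b2 := input_tape x)"
    have init: "snd (initial M x) = map \<sigma>0 [0..<K]"
      using map_initial[OF wf, of \<sigma>0 0 x] by (simp add: \<sigma>0_def tapes_M)
    obtain t u' v' where t: "t \<le> C' * (length x + length ([] :: word) + 1)"
      "(tstep \<delta>' ^^ t) (1, x, [], []) = (0, u', v', x)"
      using \<delta>'(3)[of x "[]"] by blast
    have s0: "\<sigma>0 0 = (0, cells x)" "\<sigma>0 b3 = (0, cells [])" "\<sigma>0 b2 = blank_tape"
      using b by (auto simp: \<sigma>0_def input_tape_cells blank_tape_cells)
    have d0: "distinct [0, b3, b2]" "0 < K" "b3 < K" "b2 < K" using b by auto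
    obtain m1 m2 where m: "m1 \<le> length x" "m2 \<le> length ([] :: word)"
      "reaches P1 (map \<sigma>0 [0..<K]) (2 * t + 3)
        (map (\<sigma>0(0 := (0 + int m1, cells x), b3 := (0 + int m2, cells []), b2 := input_tape x)) [0..<K])"
      using reaches_stream_tm[where \<delta> = \<delta>', OF A(1,2) \<delta>'(1,2) d0 t(2) s0(1) tape_word_input_tape range_cells[OF A(2)]
          s0(2) tape_word_input_tape range_cells[OF A(2)] s0(3)]
      unfolding P1_def by blast
    define \<sigma>1 where "\<sigma>1 = \<sigma>0(0 := (int m1, cells x), b2 := input_tape x)"
    \<comment> \<open>The second input of the copier is empty, so \<open>m2 = 0\<close> and tape
      \<open>b3\<close> is unchanged.\<close>
    have "\<sigma>0(0 := (0 + int m1, cells x), b3 := (0 + int m2, cells []), b2 := input_tape x) = \<sigma>1"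
      using m(2) s0(2) b by (auto simp: \<sigma>1_def fun_eq_iff)
    then have r1: "reaches P1 (map \<sigma>0 [0..<K]) (n1 x) (map \<sigma>1 [0..<K])"
      using m(3) t(1) by (auto simp: n1_def elim!: reaches_mono)

    have "reaches P2 (map \<sigma>1 [0..<K]) (m1 + 2) (map (\<sigma>1(0 := input_tape x)) [0..<K])"
      unfolding P2_def using b A m(1) by (intro reaches_rewind_embedded) (auto simp: \<sigma>1_def)
    moreover have "\<sigma>1(0 := input_tape x) = \<sigma>2"
      using b by (auto simp: \<sigma>1_def \<sigma>2_def \<sigma>0_def fun_eq_iff)
    ultimately have r2: "reaches P2 (map \<sigma>1 [0..<K]) (n2 x) (map \<sigma>2 [0..<K])"
      using m(1) by (auto simp: n2_def elim!: reaches_mono)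

    have i1: "map \<sigma>2 [0..<b2] = snd (initial M1 x)"
      using map_initial[OF M1(1), of \<sigma>2 0 x] b by (simp add: b2_def \<sigma>2_def \<sigma>0_def)
    obtain ts1 where ts1: "reaches M1 (snd (initial M1 x)) (n3 x) ts1" "tape_word (last ts1) (f1 x)"
      using M1(2)[of x] unfolding outputs_within_iff n3_def by blast
    have l1: "length ts1 = b2" "tapes_over (alphabet M1) ts1"
      using reaches_valid[OF M1(1) _ tapes_over_initial[OF al(1)] ts1(1)] M1(1)
      by (auto simp: b2_def initial_def wf_tm_def)
    define \<sigma>3 where "\<sigma>3 = override \<sigma>2 [0..<b2] ts1"
    have r3: "reaches P3 (map \<sigma>2 [0..<K]) (n3 x) (map \<sigma>3 [0..<K])"
      unfolding P3_def \<sigma>3_def using b M1(1) ts1(1) tapes_over_initial[OF al(1)]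
      by (intro reaches_embed_tm) (auto simp: b2_def i1[unfolded b2_def])
    have \<sigma>3: "\<sigma>3 j = \<sigma>2 j" if "j \<ge> b2" for j
      using that l1 by (simp add: \<sigma>3_def)
    have \<sigma>3': "\<sigma>3 (b2 - 1) = last ts1"
    proof -
      have "\<sigma>3 ([0..<b2] ! (b2 - 1)) = ts1 ! (b2 - 1)"
        unfolding \<sigma>3_def using l1 b by (intro override_nth) auto
      moreover have "ts1 \<noteq> []" using l1 b by auto
      ultimately show ?thesis using b l1 by (simp add: last_conv_nth)
    qed

    \<comment> \<open>The run of \<open>M1\<close> does not touch the tapes from \<open>b2\<close>
      on, so the copy of \<open>x\<close> is intact.\<close>
    have i2: "map \<sigma>3 [b2..<b3] = snd (initial M2 x)"
      unfolding b3_def using b by (intro map_initial[OF M2(1)]) (auto simp: \<sigma>3 \<sigma>2_def \<sigma>0_def)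
    obtain ts2 where ts2: "reaches M2 (snd (initial M2 x)) (n4 x) ts2" "tape_word (last ts2) (f2 x)"
      using M2(2)[of x] unfolding outputs_within_iff n4_def by blast
    have l2: "length ts2 = b3 - b2" "tapes_over (alphabet M2) ts2"
      using reaches_valid[OF M2(1) _ tapes_over_initial[OF al(2)] ts2(1)] M2(1)
      by (auto simp: b3_def initial_def wf_tm_def)
    define \<sigma>4 where "\<sigma>4 = override \<sigma>3 [b2..<b3] ts2"
    have r4: "reaches P4 (map \<sigma>3 [0..<K]) (n4 x) (map \<sigma>4 [0..<K])"
      unfolding P4_def \<sigma>4_def using b M2(1) ts2(1) tapes_over_initial[OF al(2)]
      by (intro reaches_embed_tm) (auto simp: i2 b3_def[symmetric], auto simp: b3_def)
    have \<sigma>4: "\<sigma>4 j = \<sigma>3 j" if "j < b2 \<or> j \<ge> b3" for j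
      using that l2 by (auto simp: \<sigma>4_def)
    have \<sigma>4': "\<sigma>4 (b3 - 1) = last ts2"
    proof -
      have "\<sigma>4 ([b2..<b3] ! (b3 - b2 - 1)) = ts2 ! (b3 - b2 - 1)"
        unfolding \<sigma>4_def using l2 b by (intro override_nth) auto
      moreover have "ts2 \<noteq> []" using l2 b by auto
      ultimately show ?thesis using b l2 by (simp add: last_conv_nth)
    qed

    let ?w = "T (f1 x) (f2 x)"
    obtain t' u'' v'' where t': "t' \<le> C * (length (f1 x) + length (f2 x) + 1)"
      "(tstep \<delta> ^^ t') (1, f1 x, f2 x, []) = (0, u'', v'', ?w)"
      using \<delta>(3)[of "f1 x" "f2 x"] by blast
    have "length (f1 x) \<le> len1 x" "length (f2 x) \<le> len2 x"
      using outputs_within_length[OF M1] outputs_within_length[OF M2] by (simp_all add: len1_def len2_def)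
    then have "C * (length (f1 x) + length (f2 x) + 1) \<le> C * (len1 x + len2 x + 1)"
      by (intro mult_left_mono) simp_all
    with t'(1) have t'_le: "t' \<le> C * (len1 x + len2 x + 1)" by linarith
    obtain q1 c1 where c1: "last ts1 = (q1, c1)" by fastforce
    obtain q2 c2 where c2: "last ts2 = (q2, c2)" by fastforce
    have "last ts1 \<in> set ts1" "last ts2 \<in> set ts2" using l1 l2 b by (auto intro!: last_in_set)
    then have "range (snd (last ts1)) \<subseteq> alphabet M1" "range (snd (last ts2)) \<subseteq> alphabet M2"
      using l1(2) l2(2) unfolding tapes_over_def by blast+
    then have ra: "range c1 \<subseteq> A" "range c2 \<subseteq> A"
      unfolding c1 c2 snd_conv using A(3,4) by blast+
    have s4: "\<sigma>4 (b2 - 1) = (q1, c1)" "\<sigma>4 (b3 - 1) = (q2, c2)" "\<sigma>4 b3 = blank_tape"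
      using b c1 c2 \<sigma>3' \<sigma>4' by (simp_all add: \<sigma>4 \<sigma>3 \<sigma>2_def \<sigma>0_def)
    have d4: "distinct [b2 - 1, b3 - 1, b3]" "b2 - 1 < K" "b3 - 1 < K" "b3 < K" using b by auto
    obtain k1 k2 where k: "length ?w \<le> t'"
      "reaches P5 (map \<sigma>4 [0..<K]) (2 * t' + 3)
        (map (\<sigma>4(b2 - 1 := (q1 + int k1, c1), b3 - 1 := (q2 + int k2, c2), b3 := input_tape ?w)) [0..<K])"
      using reaches_stream_tm[where \<delta> = \<delta>, OF A(1,2) \<delta>(1,2) d4 t'(2) s4(1) ts1(2)[unfolded c1] ra(1)
          s4(2) ts2(2)[unfolded c2] ra(2) s4(3)]
      unfolding P5_def by blast
    define \<sigma>5 where "\<sigma>5 = \<sigma>4(b2 - 1 := (q1 + int k1, c1), b3 - 1 := (q2 + int k2, c2), b3 := input_tape ?w)"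
    have r5: "reaches P5 (map \<sigma>4 [0..<K]) (n5 x) (map \<sigma>5 [0..<K])"
      using k(2) t'_le unfolding \<sigma>5_def n5_def by (elim reaches_mono) simp

    \<comment> \<open>Apart from the transducer output on tape \<open>b3\<close>, the last block is
      still blank.\<close>
    have i3: "map \<sigma>5 [b3..<K] = snd (initial M3 ?w)"
      unfolding K_def using b by (intro map_initial[OF M3(1)]) (auto simp: \<sigma>5_def \<sigma>4 \<sigma>3 \<sigma>2_def \<sigma>0_def)
    obtain ts3 where ts3: "reaches M3 (snd (initial M3 ?w)) (poly p3 (length ?w)) ts3" "tape_word (last ts3) (f3 ?w)"
      using M3(2)[of ?w] unfolding outputs_within_iff by blast
    \<comment> \<open>The time bound of the transducer also bounds the input length of
      \<open>M3\<close>, and hence its running time.\<close>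
    have "length ?w \<le> C * (len1 x + len2 x + 1)" using k(1) t'_le by linarith
    then have ts3': "reaches M3 (snd (initial M3 ?w)) (n6 x) ts3"
      unfolding n6_def by (rule reaches_mono[OF ts3(1) poly_nat_mono])
    have l3: "length ts3 = K - b3"
      using reaches_valid[OF M3(1) _ tapes_over_initial[OF al(3)] ts3(1)] M3(1)
      by (auto simp: K_def initial_def wf_tm_def)
    define \<sigma>6 where "\<sigma>6 = override \<sigma>5 [b3..<K] ts3"
    have r6: "reaches P6 (map \<sigma>5 [0..<K]) (n6 x) (map \<sigma>6 [0..<K])"
      unfolding P6_def \<sigma>6_def using b M3(1) ts3' tapes_over_initial[OF al(3)]
      by (intro reaches_embed_tm) (auto simp: i3 K_def[symmetric], auto simp: K_def)
    have "last (map \<sigma>6 [0..<K]) = last ts3"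
    proof -
      have "\<sigma>6 ([b3..<K] ! (K - b3 - 1)) = ts3 ! (K - b3 - 1)"
        unfolding \<sigma>6_def using l3 b by (intro override_nth) auto
      moreover have "ts3 \<noteq> []" using l3 b by auto
      ultimately show ?thesis using b l3 by (simp add: last_map last_conv_nth)
    qed
    moreover have "reaches M (snd (initial M x)) (n x) (map \<sigma>6 [0..<K])"
      unfolding M_def n_def init[unfolded M_def] using r1 r2 r3 r4 r5 r6 by (intro reaches_seq_tm)
    ultimately show ?thesis using ts3(2) unfolding outputs_within_iff by metis
  qed
  then show ?thesis by (rule FP_I[OF wf n])
qed

section \<open>The word order as a strict linear order\<close>

lemma lex_less_irrefl [simp]: "\<not> u <\<^sub>l\<^sub>e\<^sub>x u"
  by (simp add: lex_less_def lenlex_irreflexive)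

lemma lex_less_trans: "u <\<^sub>l\<^sub>e\<^sub>x v \<Longrightarrow> v <\<^sub>l\<^sub>e\<^sub>x w \<Longrightarrow> u <\<^sub>l\<^sub>e\<^sub>x w"
proof -
  have "Relation.trans (lenlex {(False, True)})"
    by (rule lenlex_transI, rule transI) auto
  then show "u <\<^sub>l\<^sub>e\<^sub>x v \<Longrightarrow> v <\<^sub>l\<^sub>e\<^sub>x w \<Longrightarrow> u <\<^sub>l\<^sub>e\<^sub>x w"
    unfolding lex_less_def by (rule transD)
qed

lemma lex_less_linear: "u <\<^sub>l\<^sub>e\<^sub>x v \<or> u = v \<or> v <\<^sub>l\<^sub>e\<^sub>x u"
proof -
  have "total (lenlex {(False, True)})"
    by (rule total_lenlex) (auto simp: total_on_def)
  then show ?thesis unfolding lex_less_def total_on_def by blast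
qed

section \<open>Piecewise definitions and merging in \<open>FP\<close>\<close>

text \<open>A one-tape machine whose start state is its halt state: the input tape is also the
  output tape.\<close>

lemma FP_id: "(\<lambda>x. x) \<in> FP"
proof (rule FP_I[OF _ poly_bounded_const])
  let ?M = "\<lparr> tapes = 1, states = {0}, alphabet = {blank, letter False, letter True}, start = 0, halt = 0,
    trans = (\<lambda>q s. (0, map (\<lambda>a. (a, Stay)) s)) \<rparr>"
  show "wf_tm ?M" by (auto simp: wf_tm_def)
  show "outputs_within ?M x x 0" for x
    using tape_word_input_tape[of x] by (simp add: outputs_within_def initial_def input_tape_cells)
qed

lemma FP_compose: "g \<in> FP \<Longrightarrow> f \<in> FP \<Longrightarrow> (\<lambda>x. g (f x)) \<in> FP"
  using FP_transduce[OF transducible_copy] by blast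

lemma FP_transduce2: "transducible T \<Longrightarrow> f \<in> FP \<Longrightarrow> g \<in> FP \<Longrightarrow> (\<lambda>x. T (f x) (g x)) \<in> FP"
  using FP_transduce[OF _ _ _ FP_id] by blast

lemmas FP_pairing = FP_transduce2[OF transducible_pair]

text \<open>Comparing a word with itself yields the empty word.\<close>

lemma FP_Nil: "(\<lambda>x. []) \<in> FP"
  using FP_transduce2[OF transducible_less FP_id FP_id] by simp

text \<open>The word \<open>enc_word x @ x\<close> is never empty, so as condition it always selects
  the first component.\<close>

lemma FP_dec_fst: "f \<in> FP \<Longrightarrow> (\<lambda>x. dec_fst (f x)) \<in> FP"
  using FP_transduce2[OF transducible_cond _ FP_pairing[OF FP_id FP_id]] by (simp add: enc_word_def)

lemma FP_dec_snd: "f \<in> FP \<Longrightarrow> (\<lambda>x. dec_snd (f x)) \<in> FP"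
  using FP_transduce2[OF transducible_cond _ FP_Nil] by simp

text \<open>Both alternatives are computed and paired; the result of the comparison then selects the
  component to be decoded.\<close>

lemma FP_if_less:
  assumes "a \<in> FP" "b \<in> FP" "f \<in> FP" "g \<in> FP"
  shows "(\<lambda>x. if a x <\<^sub>l\<^sub>e\<^sub>x b x then f x else g x) \<in> FP"
proof -
  have "(\<lambda>x. if a x <\<^sub>l\<^sub>e\<^sub>x b x then f x else g x) =
    (\<lambda>x. if (if a x <\<^sub>l\<^sub>e\<^sub>x b x then [True] else []) = [] then dec_snd (enc_word (f x) @ g x)
         else dec_fst (enc_word (f x) @ g x))"
    by auto
  also have "\<dots> \<in> FP"
    using FP_transduce2[OF transducible_cond FP_pairing[OF assms(3,4)] FP_transduce2[OF transducible_less assms(1,2)]] .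
  finally show ?thesis .
qed

text \<open>The list \<open>hs\<close> is fixed, so induction on it yields finitely many nested
  comparisons. Equality is the failure of both strict comparisons.\<close>

lemma FP_if_mem:
  assumes "a \<in> FP" "set hs \<subseteq> FP" "f \<in> FP" "g \<in> FP"
  shows "(\<lambda>x. if a x \<in> (\<lambda>h. h x) ` set hs then f x else g x) \<in> FP"
  using assms(2)
proof (induction hs)
  case Nil
  then show ?case using assms by simp
next
  case (Cons h hs)
  let ?r = "\<lambda>x. if a x \<in> (\<lambda>h. h x) ` set hs then f x else g x"
  have "(\<lambda>x. if a x \<in> (\<lambda>h. h x) ` set (h # hs) then f x else g x) =
    (\<lambda>x. if a x <\<^sub>l\<^sub>e\<^sub>x h x then ?r x else if h x <\<^sub>l\<^sub>e\<^sub>x a x then ?r x else f x)"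
  proof
    fix x
    show "(if a x \<in> (\<lambda>h. h x) ` set (h # hs) then f x else g x) =
      (if a x <\<^sub>l\<^sub>e\<^sub>x h x then ?r x else if h x <\<^sub>l\<^sub>e\<^sub>x a x then ?r x else f x)"
      using lex_less_linear[of "a x" "h x"] by auto
  qed
  also have "\<dots> \<in> FP"
    using Cons assms by (intro FP_if_less) auto
  finally show ?case .
qed

section \<open>Merging sorted tuples\<close>

text \<open>A word common to both lists is kept once, since the tuples given to the set-valued
  selector must be strictly increasing.\<close>

fun lex_merge :: "word list \<Rightarrow> word list \<Rightarrow> word list" where
  "lex_merge [] ys = ys"
| "lex_merge xs [] = xs"
| "lex_merge (x # xs) (y # ys) =
     (if x <\<^sub>l\<^sub>e\<^sub>x y then x # lex_merge xs (y # ys)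
      else if y <\<^sub>l\<^sub>e\<^sub>x x then y # lex_merge (x # xs) ys
      else x # lex_merge xs ys)"

lemma set_lex_merge: "set (lex_merge xs ys) = set xs \<union> set ys"
proof (induction xs ys rule: lex_merge.induct)
  case (3 x xs y ys)
  then show ?case using lex_less_linear[of x y] by auto
qed auto

lemma sorted_lex_merge:
  "sorted_wrt (<\<^sub>l\<^sub>e\<^sub>x) xs \<Longrightarrow> sorted_wrt (<\<^sub>l\<^sub>e\<^sub>x) ys \<Longrightarrow> sorted_wrt (<\<^sub>l\<^sub>e\<^sub>x) (lex_merge xs ys)"
proof (induction xs ys rule: lex_merge.induct)
  case (3 x xs y ys)
  then show ?case
    using lex_less_linear[of x y] by (auto simp: set_lex_merge intro: lex_less_trans)
qed auto

lemma enc_tuple_simps [simp]: "enc_tuple [] = []" "enc_tuple (x # xs) = enc_word x @ enc_tuple xs"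
  by (simp_all add: enc_tuple_def)

lemma FP_enc_tuple: "set hs \<subseteq> FP \<Longrightarrow> (\<lambda>x. enc_tuple (map (\<lambda>h. h x) hs)) \<in> FP"
  by (induction hs) (auto intro: FP_Nil FP_pairing)

text \<open>The numbers of functions are fixed, so the recursion of the merge unfolds into finitely
  many comparisons. Dropping a head from either list requires an outer induction on
  \<open>gs\<close> for all \<open>hs\<close> and an inner one on \<open>hs\<close>.\<close>

lemma FP_lex_merge:
  "set gs \<subseteq> FP \<Longrightarrow> set hs \<subseteq> FP \<Longrightarrow>
   (\<lambda>x. enc_tuple (lex_merge (map (\<lambda>h. h x) gs) (map (\<lambda>h. h x) hs))) \<in> FP"
proof (induction gs arbitrary: hs)
  case Nil
  then show ?case using FP_enc_tuple by simp
next
  case (Cons g gs)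
  note IH = Cons.IH and gs = Cons.prems(1)
  show ?case
    using Cons.prems(2)
  proof (induction hs)
    case Nil
    then show ?case using FP_enc_tuple[OF gs] by simp
  next
    case (Cons h hs)
    let ?m = "\<lambda>gs hs x. enc_tuple (lex_merge (map (\<lambda>h. h x) gs) (map (\<lambda>h. h x) hs))"
    have "?m (g # gs) (h # hs) =
      (\<lambda>x. if g x <\<^sub>l\<^sub>e\<^sub>x h x then enc_word (g x) @ ?m gs (h # hs) x
           else if h x <\<^sub>l\<^sub>e\<^sub>x g x then enc_word (h x) @ ?m (g # gs) hs x
           else enc_word (g x) @ ?m gs hs x)"
      by (rule ext) (simp del: map_map)
    also have "\<dots> \<in> FP"
    proof -
      have "g \<in> FP" "set gs \<subseteq> FP" "h \<in> FP" "set hs \<subseteq> FP" using gs Cons.prems by auto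
      moreover have "set (h # hs) \<subseteq> FP" using Cons.prems .
      ultimately show ?thesis
        using FP_if_less[OF _ _ FP_pairing[OF _ IH[of "h # hs"]]
          FP_if_less[OF _ _ FP_pairing[OF _ Cons.IH] FP_pairing[OF _ IH[of hs]]]] by blast
    qed
    finally show ?case .
  qed
qed

section \<open>The selector obtained from chains of the self-reduction\<close>

theorem theorem3p9:
  fixes L :: lang
  assumes "L \<in> SH" and "L \<le>\<^sub>m\<^sub>l\<^sub>i L"
  shows "L \<in> P_Sel"
proof -
  obtain k where k: "k \<ge> 1" "L \<in> S k" using assms(1) by (auto simp: SH_def)
  obtain s where s: "FP_tuple_set s"
    "\<And>ys. ys \<noteq> [] \<Longrightarrow> sorted_wrt (<\<^sub>l\<^sub>e\<^sub>x) ys \<Longrightarrow>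
       s ys \<subseteq> set ys \<and> (card (L \<inter> set ys) \<ge> k \<longrightarrow> s ys \<subseteq> L \<and> card (s ys) \<ge> 1)"
    using k(2) unfolding S_def by blast
  obtain F where F: "F \<in> FP" "\<And>ys. ys \<noteq> [] \<Longrightarrow> sorted_wrt (<\<^sub>l\<^sub>e\<^sub>x) ys \<Longrightarrow>
      \<exists>zs. sorted_wrt (<\<^sub>l\<^sub>e\<^sub>x) zs \<and> set zs = s ys \<and> F (enc_tuple ys) = enc_tuple zs"
    using s(1) unfolding FP_tuple_set_def by blast
  obtain g where g: "g \<in> FP" "\<And>x. x \<in> L \<longleftrightarrow> g x \<in> L" "\<And>x. x <\<^sub>l\<^sub>e\<^sub>x g x"
    using assms(2) unfolding m_li_reducible_def by blast

  \<comment> \<open>The length \<open>k\<close> is the threshold in \<open>S k\<close>, so a single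
    chain inside \<open>L\<close> already triggers the guarantee for \<open>s\<close>.\<close>
  define chain where "chain x = map (\<lambda>i. (g ^^ i) x) [0..<k]" for x
  have iter_less: "(g ^^ i) x <\<^sub>l\<^sub>e\<^sub>x (g ^^ j) x" if "i < j" for i j x
    using that
  proof (induction j)
    case (Suc j)
    then show ?case
      using g(3)[of "(g ^^ j) x"] lex_less_trans by (cases "i = j") auto
  qed simp
  have iter_mem: "(g ^^ i) x \<in> L \<longleftrightarrow> x \<in> L" for i x
    by (induction i) (use g(2) in auto)
  have chain_sorted: "sorted_wrt (<\<^sub>l\<^sub>e\<^sub>x) (chain x)" for x
    unfolding chain_def by (auto simp: sorted_wrt_iff_nth_less iter_less)
  have chain_mem: "z \<in> set (chain x) \<Longrightarrow> z \<in> L \<longleftrightarrow> x \<in> L" for x z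
    using iter_mem by (auto simp: chain_def)
  have card_chain: "card (set (chain x)) = k" for x
  proof -
    have "distinct (chain x)"
      using chain_sorted[of x] by (metis distinct_conv_nth lex_less_irrefl linorder_neqE_nat sorted_wrt_iff_nth_less)
    then show ?thesis by (simp add: distinct_card) (simp add: chain_def)
  qed

  \<comment> \<open>If the first selected word lies in both chains, \<open>x\<close> and
    \<open>y\<close> have the same status and preferring \<open>x\<close> is safe. If nothing is
    selected, the decoded word is a default, and the result is still \<open>x\<close> or
    \<open>y\<close>.\<close>
  define sel where "sel x y =
    (if dec_fst (F (enc_tuple (lex_merge (chain x) (chain y)))) \<in> set (chain x) then x else y)" for x y
  have sel_mem: "sel x y \<in> L" if "x \<in> L \<or> y \<in> L" for x y
  proof -
    define ys where "ys = lex_merge (chain x) (chain y)"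
    have set_ys: "set ys = set (chain x) \<union> set (chain y)" by (simp add: ys_def set_lex_merge)
    have "k \<le> card (L \<inter> set ys)"
    proof -
      obtain z where z: "z \<in> {x, y}" "z \<in> L" using \<open>x \<in> L \<or> y \<in> L\<close> by auto
      then have "set (chain z) \<subseteq> L \<inter> set ys" using chain_mem set_ys by auto
      then show ?thesis using card_mono[of "L \<inter> set ys" "set (chain z)"] card_chain by simp
    qed
    moreover have "ys \<noteq> []"
    proof
      assume "ys = []"
      then have "set (chain x) = {}" using set_ys by simp
      then show False using card_chain[of x] k(1) by simp
    qed
    moreover have "sorted_wrt (<\<^sub>l\<^sub>e\<^sub>x) ys" unfolding ys_def by (intro sorted_lex_merge chain_sorted)
    ultimately obtain zs where zs: "set zs \<subseteq> L" "card (set zs) \<ge> 1" "set zs \<subseteq> set ys" "F (enc_tuple ys) = enc_tuple zs"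
      using F(2) s(2) by metis
    \<comment> \<open>\<open>card (set zs) \<ge> 1\<close> excludes the empty list.\<close>
    then obtain z zs' where "zs = z # zs'" by (cases zs) auto
    then have z: "z \<in> L" "z \<in> set ys" "dec_fst (F (enc_tuple ys)) = z" using zs by auto
    \<comment> \<open>A word \<open>z\<close> of \<open>L\<close> outside the chain of
      \<open>x\<close> lies in that of \<open>y\<close>, and in either case its membership passes to
      the start of the chain.\<close>
    then show ?thesis
      using chain_mem set_ys unfolding sel_def ys_def[symmetric] by auto
  qed

  \<comment> \<open>\<open>FP_pair\<close> asks for a function of one encoded word, so the arguments
    of \<open>sel\<close> are decoded first.\<close>
  define X where "X = dec_fst"
  define Y where "Y e = dec_fst (dec_snd e)" for e
  have XY: "X \<in> FP" "Y \<in> FP"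
    using FP_dec_fst[OF FP_id] FP_dec_fst[OF FP_dec_snd[OF FP_id]] unfolding X_def Y_def by simp_all
  have iter_FP: "(\<lambda>e. (g ^^ i) (h e)) \<in> FP" if "h \<in> FP" for i h
    by (induction i) (use that FP_compose[OF g(1)] in auto)
  \<comment> \<open>The chains are rewritten as fixed lists of \<open>k\<close> functions in
    \<open>FP\<close>, the form in which merging and membership tests were treated.\<close>
  define xs where "xs = map (\<lambda>i e. (g ^^ i) (X e)) [0..<k]"
  define ys where "ys = map (\<lambda>i e. (g ^^ i) (Y e)) [0..<k]"
  have xs: "set xs \<subseteq> FP" "map (\<lambda>h. h e) xs = chain (X e)" for e
    using iter_FP XY by (auto simp: xs_def chain_def)
  have ys: "set ys \<subseteq> FP" "map (\<lambda>h. h e) ys = chain (Y e)" for e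
    using iter_FP XY by (auto simp: ys_def chain_def)
  have "(\<lambda>e. if dec_fst (F (enc_tuple (lex_merge (map (\<lambda>h. h e) xs) (map (\<lambda>h. h e) ys)))) \<in> (\<lambda>h. h e) ` set xs
             then X e else Y e) \<in> FP"
    by (rule FP_if_mem[OF FP_dec_fst[OF FP_compose[OF F(1) FP_lex_merge[OF xs(1) ys(1)]]] xs(1) XY])
  moreover have "(\<lambda>h. h e) ` set xs = set (chain (X e))" for e
    using xs(2)[of e] by (metis list.set_map)
  ultimately have "(\<lambda>e. sel (X e) (Y e)) \<in> FP"
    unfolding sel_def xs(2) ys(2) by simp
  moreover have "sel (X (enc_tuple [x, y])) (Y (enc_tuple [x, y])) = sel x y" for x y
    \<comment> \<open>The second component is the last, so the word following its code is
      empty.\<close>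
    using dec_fst_enc[of y "[]"] by (simp add: X_def Y_def)
  ultimately have "FP_pair sel"
    unfolding FP_pair_def by (intro bexI[of _ "\<lambda>e. sel (X e) (Y e)"]) simp_all
  moreover have "sel x y \<in> {x, y}" for x y by (simp add: sel_def)
  ultimately show ?thesis
    using sel_mem unfolding P_Sel_def by blast
qed

end
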